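(* Let $2<\beta<3$, let the average expected degree satisfy $\bar w>1$, and let $g>1$ be the memory-assisted compression gain. Let $G(\beta)$ be (the giant component of) the random power-law graph with parameter $\beta$ on $N$ vertices with expected degrees $w_u$, average expected degree $\bar w$, and minimum expected degree $w_{\min}$. Let $$\gamma=\Bigl(1-\frac{1}{\beta-1}\Bigr)^2\frac{\beta-1}{3-\beta},$$ let $l>0$ be the solution of $$l^{3-\beta}-\frac{1}{\bar w\,\gamma}=0,$$ and let the core be $\mathcal C=\{u : w_u> l\,w_{\min}\}$. Then, in order to achieve a non-vanishing network-wide gain $\mathcal G(g)$, it is sufficient to deploy memories at the nodes of $\mathcal C$. That is, if the set of memory units is the set of nodes of $\mathcal C$, then, with high probability, the network-wide gain $\mathcal G(g)$ remains greater than $1$ (does not vanish to the trivial value $1$) as $N\to\infty$.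
   Context: **Random power-law graph $G(\beta)$.** Given positive expected degrees, one for each of $N$ vertices, let $\rho=1/\sum_i w_i$. For every two vertices $v_i,v_j$, the edge $v_iv_j$ is present with probability $p_{ij}=w_iw_j\rho$ (the weights are such that $p_{ij}\le 1$), independently of the other edges. The random power-law graph with parameter $\beta$ has expected degrees $$w_i=c\,i^{-\frac1{\beta-1}},\qquad i \text{ an integer with } i_0\le i< N+i_0,$$ where, with $\bar w$ the average expected degree and $\Delta$ the maximum expected degree, $$c=\frac{\beta-2}{\beta-1}\,\bar w\,N^{\frac1{\beta-1}},\qquad i_0=N\left(\frac{\bar w(\beta-2)}{\Delta(\beta-1)}\right)^{\beta-1}.$$ When $\bar w>1$ and $N$ is large, this graph has with high probability a unique giant component (of size linear in $N$), and all other components have size $O(\log N)$. Only connected networks are considered, so $G(\beta)$ and its vertex set $V$ refer to this giant component. **Network-wide gain.** For vertices $u,v$ of a connected graph with vertex set $V$, let $d(u,v)$ be the hop distance. Let $\boldsymbol\mu\subseteq V$ be the set of memory units (the memories are said to be deployed at these nodes). Every node $S\in V$ is a source that sends one unit of flow to every other node $D\in V\setminus\{S\}$. A flow routed through a memory unit has its cost divided by $g$ on the portion of the walk from $S$ to the memory unit. Flows are routed along lowest-cost walks. The effective distance from $S$ to $D$ is therefore $$\hat d_{S,D}=\min\Bigl\{d(S,D),\ \min_{\mu\in\boldsymbol\mu}\Bigl(\tfrac{d(S,\mu)}{g}+d(\mu,D)\Bigr)\Bigr\}.$$ The network-wide gain is $$\mathcal G(g)=\frac{\sum_{S\in V}\sum_{D\in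 V\setminus\{S\}} d(S,D)}{\sum_{S\in V}\sum_{D\in V\setminus\{S\}}\hat d_{S,D}}\ \ge 1.$$ The gain is called non-vanishing if it stays greater than $1$ as $N\to\infty$. *)

theory Defs
  imports "HOL-Probability.Probability" "HOL-Probability.Product_PMF"
begin

text \<open>
  Simple graphs are given by their edge sets; an edge is a two-element set of vertices.
\<close>

definition adj :: "'a set set \<Rightarrow> ('a \<times> 'a) set" where
  "adj E = {(u, v). {u, v} \<in> E}"

text \<open>The value of \<open>hop_dist\<close> is meaningful only for vertices in the same component.\<close>

definition hop_dist :: "'a set set \<Rightarrow> 'a \<Rightarrow> 'a \<Rightarrow> nat" where
  "hop_dist E u v = (LEAST n. (u, v) \<in> adj E ^^ n)"

definition components :: "'a set \<Rightarrow> 'a set set \<Rightarrow> 'a set set" where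
  "components X E = (\<lambda>v. (adj E)\<^sup>* `` {v}) ` X"

definition giant_component :: "'a set \<Rightarrow> 'a set set \<Rightarrow> 'a set \<Rightarrow> bool" where
  "giant_component X E V \<longleftrightarrow>
     V \<in> components X E \<and> (\<forall>C\<in>components X E. card C \<le> card V)"

text \<open>
  In \<open>eff_dist E M g\<close> and \<open>network_gain E V M g\<close>, the set \<open>M\<close> is the (finite, possibly empty)
  set of memory units, a subset of the component \<open>V\<close>. Shortest walks between vertices of a
  component stay in it, so the distances in \<open>E\<close> are those of the component.
\<close>

definition eff_dist :: "'a set set \<Rightarrow> 'a set \<Rightarrow> real \<Rightarrow> 'a \<Rightarrow> 'a \<Rightarrow> real" where
  "eff_dist E M g S D =
     Min (insert (real (hop_dist E S D))
            ((\<lambda>m. real (hop_dist E S m) / g + real (hop_dist E m D)) ` M))"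

definition network_gain :: "'a set set \<Rightarrow> 'a set \<Rightarrow> 'a set \<Rightarrow> real \<Rightarrow> real" where
  "network_gain E V M g =
     (\<Sum>S\<in>V. \<Sum>D\<in>V - {S}. real (hop_dist E S D)) /
     (\<Sum>S\<in>V. \<Sum>D\<in>V - {S}. eff_dist E M g S D)"

text \<open>
  The power-law expected degrees, with exponent \<open>\<beta>\<close>, average expected degree \<open>wbar\<close>, maximum
  expected degree \<open>\<Delta>\<close> and \<open>N\<close> vertices. As usual for this model, \<open>wbar\<close> and \<open>\<Delta>\<close> are parameters
  of the formulas for \<open>c\<close> and \<open>i\<^sub>0\<close>. The largest weight is \<open>\<Delta>\<close> when \<open>i\<^sub>0\<close> is an integer.
  The arithmetic mean of the weights is only asymptotically \<open>wbar\<close>, and this requires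
  \<open>i\<^sub>0 / N \<longlonglongrightarrow> 0\<close>, i.e. \<open>\<Delta> \<longlonglongrightarrow> \<infinity>\<close> as \<open>N\<close> grows.
\<close>

definition pl_c :: "real \<Rightarrow> real \<Rightarrow> nat \<Rightarrow> real" where
  "pl_c \<beta> wbar N = (\<beta> - 2) / (\<beta> - 1) * wbar * real N powr (1 / (\<beta> - 1))"

definition pl_i0 :: "real \<Rightarrow> real \<Rightarrow> real \<Rightarrow> nat \<Rightarrow> real" where
  "pl_i0 \<beta> wbar \<Delta> N = real N * ((wbar * (\<beta> - 2)) / (\<Delta> * (\<beta> - 1))) powr (\<beta> - 1)"

text \<open>Since \<open>i\<^sub>0 \<ge> 0\<close>, the integer indices of the vertices are natural numbers.\<close>

definition pl_vertices :: "real \<Rightarrow> real \<Rightarrow> real \<Rightarrow> nat \<Rightarrow> nat set" where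
  "pl_vertices \<beta> wbar \<Delta> N =
     {i. pl_i0 \<beta> wbar \<Delta> N \<le> real i \<and> real i < real N + pl_i0 \<beta> wbar \<Delta> N}"

definition pl_weight :: "real \<Rightarrow> real \<Rightarrow> nat \<Rightarrow> nat \<Rightarrow> real" where
  "pl_weight \<beta> wbar N i = pl_c \<beta> wbar N * real i powr (- 1 / (\<beta> - 1))"

definition pl_wmin :: "real \<Rightarrow> real \<Rightarrow> real \<Rightarrow> nat \<Rightarrow> real" where
  "pl_wmin \<beta> wbar \<Delta> N = Min (pl_weight \<beta> wbar N ` pl_vertices \<beta> wbar \<Delta> N)"

definition pl_rho :: "real \<Rightarrow> real \<Rightarrow> real \<Rightarrow> nat \<Rightarrow> real" where
  "pl_rho \<beta> wbar \<Delta> N = 1 / (\<Sum>i\<in>pl_vertices \<beta> wbar \<Delta> N. pl_weight \<beta> wbar N i)"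

text \<open>For an edge \<open>e = {i, j}\<close> with \<open>i \<noteq> j\<close> this is \<open>w\<^sub>i w\<^sub>j \<rho>\<close>.\<close>

definition pl_edge_prob :: "real \<Rightarrow> real \<Rightarrow> real \<Rightarrow> nat \<Rightarrow> nat set \<Rightarrow> real" where
  "pl_edge_prob \<beta> wbar \<Delta> N e = (\<Prod>i\<in>e. pl_weight \<beta> wbar N i) * pl_rho \<beta> wbar \<Delta> N"

definition pl_pairs :: "real \<Rightarrow> real \<Rightarrow> real \<Rightarrow> nat \<Rightarrow> nat set set" where
  "pl_pairs \<beta> wbar \<Delta> N = {e. e \<subseteq> pl_vertices \<beta> wbar \<Delta> N \<and> card e = 2}"

text \<open>
  The distribution of the random edge set. The Bernoulli parameter is truncated to the unit
  interval, so this is the intended model only if all edge probabilities are at most 1.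
\<close>

definition pl_graph :: "real \<Rightarrow> real \<Rightarrow> real \<Rightarrow> nat \<Rightarrow> nat set set pmf" where
  "pl_graph \<beta> wbar \<Delta> N =
     map_pmf (\<lambda>f. {e. f e})
       (Pi_pmf (pl_pairs \<beta> wbar \<Delta> N) False
          (\<lambda>e. bernoulli_pmf (pl_edge_prob \<beta> wbar \<Delta> N e)))"

definition pl_core :: "real \<Rightarrow> real \<Rightarrow> real \<Rightarrow> nat \<Rightarrow> real \<Rightarrow> nat set \<Rightarrow> nat set" where
  "pl_core \<beta> wbar \<Delta> N l V =
     {u \<in> V. pl_weight \<beta> wbar N u > l * pl_wmin \<beta> wbar \<Delta> N}"

end

theory Submission imports Defs "HOL-Real_Asymp.Real_Asymp" begin

text \<open>
  A memory at \<open>D\<close> serves every flow to \<open>D\<close> at cost \<open>d(S,D)/g\<close>, and by the triangle inequality the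
  distances to a positive fraction of the vertices make up a positive fraction of all distances.
  So it suffices that, with high probability, the core contains a positive fraction of every largest
  component \<open>V\<close>.

  First, \<open>V\<close> has linear size: as \<open>\<beta> < 3\<close>, the vertices of index at most \<open>\<tau> N\<close> span, for small \<open>\<tau>\<close>, a
  random graph of large average degree, in which any two disjoint sets containing a third of the
  vertices are joined by an edge. Second, the choice of \<open>l\<close> makes the graph on the vertices outside
  the core subcritical, so few of them lie in non-core components of size at least a constant \<open>A\<close>.
  The other non-core vertices of \<open>V\<close> lie in non-core components of size less than \<open>A\<close> attached to a
  core vertex of \<open>V\<close>, so their number is at most \<open>A\<close> times the degree sum of \<open>V \<inter> core\<close>, and few core
  vertices have a small degree sum. Both error terms change by a bounded amount when one edge is
  changed, so the Efron-Stein inequality concentrates them around their small means.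
\<close>

subsection \<open>Random edge sets\<close>

text \<open>The heavy tail shapes the argument. For \<beta> < 3 the second moment of all weights,
  divided by N, is unbounded, so a branching comparison is possible only outside the core, and the
  degree sum over core vertices has no useful second-moment bound. What remains is uniform
  integrability of the weights themselves, from \<beta> > 2: degrees are truncated at a constant,
  and the few very heavy vertices are charged with their whole weight.

  The equation for \<open>l\<close> enters as follows. For l \<ge> 1 the mean offspring number of an
  exploration outside the core is asymptotically at most
  \<open>wbar * \<gamma> * (l powr (3 - \<beta>) - 1)\<close>, which equals
  \<open>1 - wbar * \<gamma>\<close>, so there is a fixed margin below 1. For l < 1 every vertex
  belongs to the core.

  The largest component depends on the random edges. Probabilistic estimates are therefore made only
  for sums over fixed vertex sets, and the step to \<open>V\<close> is deterministic.\<close>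

definition random_edges :: "'a set \<Rightarrow> ('a \<Rightarrow> real) \<Rightarrow> 'a set pmf" where
  "random_edges P q = map_pmf Collect (Pi_pmf P False (\<lambda>e. bernoulli_pmf (q e)))"

abbreviation expect :: "'a set \<Rightarrow> ('a \<Rightarrow> real) \<Rightarrow> ('a set \<Rightarrow> real) \<Rightarrow> real" where
  "expect P q F \<equiv> measure_pmf.expectation (random_edges P q) F"

lemma set_random_edges:
  assumes "finite P" shows "set_pmf (random_edges P q) \<subseteq> Pow P"
  using set_Pi_pmf_subset[OF assms, of False "\<lambda>e. bernoulli_pmf (q e)"]
  by (auto simp: random_edges_def)

lemma finite_random_edges [simp]: "finite P \<Longrightarrow> finite (set_pmf (random_edges P q))"
  using set_random_edges by (metis finite_Pow_iff finite_subset)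

lemma integrable_random_edges [simp]:
  fixes F :: "'a set \<Rightarrow> real"
  shows "finite P \<Longrightarrow> integrable (measure_pmf (random_edges P q)) F"
  by (simp add: integrable_measure_pmf_finite)

lemma expect_cong:
  fixes F :: "'a set \<Rightarrow> real"
  assumes "finite P" and "\<And>E. E \<subseteq> P \<Longrightarrow> F E = G E"
  shows "expect P q F = expect P q G"
  using set_random_edges[OF assms(1), of q] assms(2)
  by (intro integral_cong_AE) (auto simp: AE_measure_pmf_iff)

lemma expect_mono:
  fixes F :: "'a set \<Rightarrow> real"
  assumes "finite P" and "\<And>E. E \<subseteq> P \<Longrightarrow> F E \<le> G E"
  shows "expect P q F \<le> expect P q G"
  using set_random_edges[OF assms(1), of q] assms
  by (intro integral_mono_AE) (auto simp: AE_measure_pmf_iff)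

text \<open>Conditioning on the coin of \<open>e\<close>. It drives the induction for the variance
  and gives the independence of one edge from the rest.\<close>

lemma expect_insert:
  fixes F :: "'a set \<Rightarrow> real"
  assumes "finite P" "e \<notin> P" "0 \<le> q e" "q e \<le> 1"
  shows "expect (insert e P) q F
    = q e * expect P q (\<lambda>E. F (insert e E)) + (1 - q e) * expect P q F"
proof -
  \<comment> \<open>Overwriting the coin of \<open>e\<close> by \<open>False\<close> amounts to
    deleting \<open>e\<close>, which changes nothing on samples from \<open>P\<close>.\<close>
  have eq: "random_edges (insert e P) q
    = bernoulli_pmf (q e) \<bind> (\<lambda>b. map_pmf (\<lambda>E. if b then insert e E else E - {e}) (random_edges P q))"
    unfolding random_edges_def Pi_pmf_insert'[OF assms(1,2)] map_bind_pmf map_pmf_comp map_pmf_def[symmetric]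
    by (intro bind_pmf_cong refl) (auto simp: map_pmf_def bind_assoc_pmf bind_return_pmf intro!: bind_pmf_cong arg_cong[where f=return_pmf] split: if_splits)
  have "expect (insert e P) q F = q e * expect P q (\<lambda>E. F (insert e E)) + (1 - q e) * expect P q (\<lambda>E. F (E - {e}))"
    unfolding eq using assms
    by (subst pmf_expectation_bind[where A = UNIV]) (auto simp: UNIV_bool)
  also have "expect P q (\<lambda>E. F (E - {e})) = expect P q F"
    using assms by (intro expect_cong) (auto intro!: arg_cong[where f = F])
  finally show ?thesis .
qed

text \<open>Efron-Stein inequality, obtained by revealing one coin at a time. The factor
  \<open>q e\<close> is essential in a sparse graph: the bound is proportional to the expected
  number of edges instead of the number of pairs.\<close>

lemma variance_le_lipschitz:
  fixes F :: "'a set \<Rightarrow> real"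
  assumes "finite P" "\<And>e. e \<in> P \<Longrightarrow> 0 \<le> q e \<and> q e \<le> 1"
    and "\<And>e E. e \<in> P \<Longrightarrow> \<bar>F (insert e E) - F E\<bar> \<le> c e"
  shows "measure_pmf.variance (random_edges P q) F \<le> (\<Sum>e\<in>P. (c e)\<^sup>2 * q e)"
proof -
  have var: "measure_pmf.variance (random_edges P q) G = expect P q (\<lambda>E. (G E)\<^sup>2) - (expect P q G)\<^sup>2"
    if "finite P" for P and G :: "'a set \<Rightarrow> real"
    using that by (intro measure_pmf.variance_eq) auto
  have "expect P q (\<lambda>E. (F E)\<^sup>2) - (expect P q F)\<^sup>2 \<le> (\<Sum>e\<in>P. (c e)\<^sup>2 * q e)"
    using assms
  proof (induction P arbitrary: F rule: finite_induct)
    case empty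
    then show ?case by (simp add: random_edges_def)
  next
    case (insert e P)
    define F1 where "F1 = (\<lambda>E. F (insert e E))"
    define m0 where "m0 = expect P q F"
    define m1 where "m1 = expect P q F1"
    define s0 where "s0 = expect P q (\<lambda>E. (F E)\<^sup>2)"
    define s1 where "s1 = expect P q (\<lambda>E. (F1 E)\<^sup>2)"
    define Q where "Q = (\<Sum>e\<in>P. (c e)\<^sup>2 * q e)"
    have q: "0 \<le> q e" "q e \<le> 1" using insert.prems by auto
    have v0: "s0 - m0\<^sup>2 \<le> Q" unfolding s0_def m0_def Q_def
      using insert.prems by (intro insert.IH) auto
    have v1: "s1 - m1\<^sup>2 \<le> Q" unfolding s1_def m1_def Q_def
    proof (intro insert.IH)
      show "\<bar>F1 (insert e' E) - F1 E\<bar> \<le> c e'" if "e' \<in> P" for e' E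
        using insert.prems(2)[of e' "insert e E"] that by (simp add: F1_def insert_commute)
    qed (use insert.prems in auto)
    have "\<bar>m1 - m0\<bar> = \<bar>expect P q (\<lambda>E. F1 E - F E)\<bar>"
      using insert.hyps by (simp add: m0_def m1_def)
    also have "\<dots> \<le> expect P q (\<lambda>E. \<bar>F1 E - F E\<bar>)" by (rule integral_abs_bound)
    also have "\<dots> \<le> expect P q (\<lambda>E. c e)"
      using insert by (intro expect_mono) (auto simp: F1_def)
    finally have "\<bar>m1 - m0\<bar> \<le> c e" by simp
    then have d: "(m1 - m0)\<^sup>2 \<le> (c e)\<^sup>2" by (metis abs_ge_zero power2_abs power_mono)
    have "expect (insert e P) q (\<lambda>E. (F E)\<^sup>2) - (expect (insert e P) q F)\<^sup>2
      = q e * s1 + (1 - q e) * s0 - (q e * m1 + (1 - q e) * m0)\<^sup>2"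
      using insert.hyps q by (simp add: expect_insert s0_def s1_def m0_def m1_def F1_def)
    \<comment> \<open>Law of total variance for the coin of \<open>e\<close>: the mean of the two
      conditional variances plus the variance of the conditional mean.\<close>
    also have "\<dots> = q e * (s1 - m1\<^sup>2) + (1 - q e) * (s0 - m0\<^sup>2) + q e * (1 - q e) * (m1 - m0)\<^sup>2"
      by (simp add: algebra_simps power2_eq_square)
    also have "\<dots> \<le> q e * Q + (1 - q e) * Q + q e * (c e)\<^sup>2"
    proof (intro add_mono mult_left_mono v0 v1)
      have "q e * (1 - q e) * (m1 - m0)\<^sup>2 \<le> q e * (m1 - m0)\<^sup>2"
        using q by (intro mult_right_mono) (auto simp: mult_left_le)
      also have "\<dots> \<le> q e * (c e)\<^sup>2" using d q by (intro mult_left_mono)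
      finally show "q e * (1 - q e) * (m1 - m0)\<^sup>2 \<le> q e * (c e)\<^sup>2" .
    qed (use q in auto)
    also have "\<dots> = (\<Sum>e\<in>insert e P. (c e)\<^sup>2 * q e)"
      using insert.hyps by (simp add: Q_def algebra_simps)
    finally show ?case .
  qed
  then show ?thesis using assms(1) by (simp add: var)
qed

lemma expect_edge_indep:
  fixes F :: "'a set \<Rightarrow> real"
  assumes "finite P" "e \<in> P" "0 \<le> q e" "q e \<le> 1" "\<And>E. F (insert e E) = F E"
  shows "expect P q (\<lambda>E. of_bool (e \<in> E) * F E) = q e * expect P q F"
proof -
  define P' where "P' = P - {e}"
  have P: "P = insert e P'" "e \<notin> P'" "finite P'" using assms by (auto simp: P'_def)
  have "expect P' q (\<lambda>E. of_bool (e \<in> E) * F E) = expect P' q (\<lambda>E. 0)"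
    using P by (intro expect_cong) auto
  then show ?thesis
    using P assms by (simp add: expect_insert algebra_simps)
qed

lemma prob_no_edges:
  assumes "finite P" "\<And>e. e \<in> P \<Longrightarrow> 0 \<le> q e \<and> q e \<le> 1" "F \<subseteq> P"
  shows "measure_pmf.prob (random_edges P q) {E. E \<inter> F = {}} \<le> exp (- (\<Sum>e\<in>F. q e))"
proof -
  have "measure_pmf.prob (random_edges P q) {E. E \<inter> F = {}}
    = measure_pmf.prob (Pi_pmf P False (\<lambda>e. bernoulli_pmf (q e))) (Pi P (\<lambda>e. if e \<in> F then {False} else UNIV))"
    unfolding random_edges_def measure_map_pmf
    using assms(3) by (intro arg_cong[where f="measure _"]) (auto simp: Pi_def split: if_splits)
  also have "\<dots> = (\<Prod>e\<in>P. measure_pmf.prob (bernoulli_pmf (q e)) (if e \<in> F then {False} else UNIV))"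
    using assms by (intro measure_Pi_pmf_Pi)
  also have "\<dots> = (\<Prod>e\<in>F. 1 - q e)"
    using assms by (intro prod.mono_neutral_cong_right) (auto simp: measure_pmf_single subset_iff)
  also have "\<dots> \<le> (\<Prod>e\<in>F. exp (- q e))"
  proof (intro prod_mono conjI)
    show "1 - q e \<le> exp (- q e)" for e using exp_ge_add_one_self[of "- q e"] by simp
  qed (use assms in auto)
  also have "\<dots> = exp (- (\<Sum>e\<in>F. q e))"
    using assms by (simp add: exp_sum finite_subset sum_negf[symmetric])
  finally show ?thesis .
qed

text \<open>Chebyshev on top of the variance bound. With constant \<open>c\<close>, expected edge
  count of order N and \<open>s\<close> of order N, the failure probability is of order 1/N. An
  upper bound \<open>m\<close> for the mean suffices, since only the upper tail is wanted.\<close>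

lemma prob_lipschitz_deviation:
  fixes F :: "'a set \<Rightarrow> real"
  assumes "finite P" "\<And>e. e \<in> P \<Longrightarrow> 0 \<le> q e \<and> q e \<le> 1"
    and "\<And>e E. e \<in> P \<Longrightarrow> \<bar>F (insert e E) - F E\<bar> \<le> c"
    and "expect P q F \<le> m" "0 < s"
  shows "measure_pmf.prob (random_edges P q) {E. F E > m + s} \<le> c\<^sup>2 * (\<Sum>e\<in>P. q e) / s\<^sup>2"
proof -
  have "measure_pmf.prob (random_edges P q) {E. F E > m + s}
    \<le> measure_pmf.prob (random_edges P q) {E \<in> space (measure_pmf (random_edges P q)). s \<le> \<bar>F E - expect P q F\<bar>}"
    using assms by (intro measure_pmf.finite_measure_mono) auto
  also have "\<dots> \<le> measure_pmf.variance (random_edges P q) F / s\<^sup>2"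
    using assms by (intro measure_pmf.Chebyshev_inequality) auto
  also have "\<dots> \<le> c\<^sup>2 * (\<Sum>e\<in>P. q e) / s\<^sup>2"
    unfolding sum_distrib_left using assms by (intro divide_right_mono variance_le_lipschitz) auto
  finally show ?thesis .
qed

subsection \<open>Hop distances and the gain\<close>

lemma adj_iff: "(u, v) \<in> adj E \<longleftrightarrow> {u, v} \<in> E"
  by (simp add: adj_def)

lemma sym_adj: "sym (adj E)"
  by (auto simp: sym_def adj_iff insert_commute)

lemma sym_rtrancl_adj: "sym ((adj E)\<^sup>*)"
  by (intro sym_rtrancl sym_adj)

lemma adj_pow_sym: "(u, v) \<in> adj E ^^ n \<Longrightarrow> (v, u) \<in> adj E ^^ n"
proof (induction n arbitrary: v)
  case (Suc n)
  then obtain x where "(u, x) \<in> adj E ^^ n" "(x, v) \<in> adj E" by auto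
  then have "(v, x) \<in> adj E" "(x, u) \<in> adj E ^^ n"
    using Suc.IH by (auto simp: adj_iff insert_commute)
  then show ?case by (rule relpow_Suc_I2)
qed simp

lemma hop_dist_commute: "hop_dist E u v = hop_dist E v u"
  unfolding hop_dist_def by (metis adj_pow_sym)

lemma hop_dist_self [simp]: "hop_dist E u u = 0"
  unfolding hop_dist_def by (intro Least_eq_0) simp

lemma hop_dist_path:
  assumes "(u, v) \<in> (adj E)\<^sup>*"
  shows "(u, v) \<in> adj E ^^ hop_dist E u v"
  using assms unfolding hop_dist_def rtrancl_power by (rule LeastI_ex)

lemma hop_dist_eq_0_iff:
  assumes "(u, v) \<in> (adj E)\<^sup>*"
  shows "hop_dist E u v = 0 \<longleftrightarrow> u = v"
  using hop_dist_path[OF assms] by auto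

lemma hop_dist_triangle:
  assumes "(u, v) \<in> (adj E)\<^sup>*" "(v, x) \<in> (adj E)\<^sup>*"
  shows "hop_dist E u x \<le> hop_dist E u v + hop_dist E v x"
proof -
  have "(u, x) \<in> adj E ^^ (hop_dist E u v + hop_dist E v x)"
    unfolding relpow_add using hop_dist_path[OF assms(1)] hop_dist_path[OF assms(2)] by auto
  then show ?thesis unfolding hop_dist_def[of E u x] by (rule Least_le)
qed

lemma components_connected:
  assumes "V \<in> components X E" "u \<in> V" "v \<in> V"
  shows "(u, v) \<in> (adj E)\<^sup>*"
proof -
  obtain x where "(x, u) \<in> (adj E)\<^sup>*" "(x, v) \<in> (adj E)\<^sup>*"
    using assms by (auto simp: components_def)
  then show ?thesis using sym_rtrancl_adj[of E] by (meson rtrancl_trans symE)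
qed

lemma components_closed:
  assumes "V \<in> components X E" "u \<in> V" "(u, v) \<in> (adj E)\<^sup>*"
  shows "v \<in> V"
  using assms by (auto simp: components_def)

lemma rtrancl_adj_in:
  assumes "(u, v) \<in> (adj E)\<^sup>*" "u \<in> X" "E \<subseteq> Pow X"
  shows "v \<in> X"
  using assms by (induction rule: rtrancl_induct) (auto simp: adj_iff)

lemma components_subset:
  assumes "E \<subseteq> Pow X" "V \<in> components X E"
  shows "V \<subseteq> X"
  using assms by (auto simp: components_def dest: rtrancl_adj_in)

text \<open>Sum the triangle inequality \<open>d(S,D) \<le> d(S,k) + d(k,D)\<close> over all \<open>S\<close>, \<open>D\<close> and \<open>k \<in> K\<close>.\<close>

lemma sum_hop_dist_le_hubs:
  assumes V: "V \<in> components X E" and K: "K \<subseteq> V" and "finite V"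
  shows "real (card K) * (\<Sum>S\<in>V. \<Sum>D\<in>V. real (hop_dist E S D))
    \<le> 2 * real (card V) * (\<Sum>S\<in>V. \<Sum>k\<in>K. real (hop_dist E S k))"
proof -
  let ?d = "\<lambda>u v. real (hop_dist E u v)"
  have "real (card K) * (\<Sum>S\<in>V. \<Sum>D\<in>V. ?d S D) = (\<Sum>S\<in>V. \<Sum>D\<in>V. \<Sum>k\<in>K. ?d S D)"
    by (simp add: sum_distrib_left)
  also have "\<dots> \<le> (\<Sum>S\<in>V. \<Sum>D\<in>V. \<Sum>k\<in>K. ?d S k + ?d k D)"
  proof (intro sum_mono)
    fix S D k assume "S \<in> V" "D \<in> V" "k \<in> K"
    then have "(S, k) \<in> (adj E)\<^sup>*" "(k, D) \<in> (adj E)\<^sup>*"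
      using components_connected[OF V] K by blast+
    from hop_dist_triangle[OF this] show "?d S D \<le> ?d S k + ?d k D"
      by linarith
  qed
  also have "\<dots> = (\<Sum>S\<in>V. \<Sum>D\<in>V. \<Sum>k\<in>K. ?d S k) + (\<Sum>S\<in>V. \<Sum>D\<in>V. \<Sum>k\<in>K. ?d D k)"
    by (simp add: sum.distrib hop_dist_commute[of E _ "_::'a"])
  also have "\<dots> = 2 * real (card V) * (\<Sum>S\<in>V. \<Sum>k\<in>K. ?d S k)"
    by (simp add: sum_distrib_left mult.assoc)
  finally show ?thesis .
qed

text \<open>The saving is \<open>1 - 1 / g\<close> on the flows to \<open>K\<close>, and by the hub
  inequality these carry at least the share \<open>\<delta> / 2\<close> of the total distance; the 2
  stems from the two legs of the triangle inequality. Two vertices make the denominator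
  positive.\<close>

lemma network_gain_ge:
  assumes V: "V \<in> components X E" and K: "K \<subseteq> V" and fin: "finite V"
    and g: "g > 1" and two: "card V \<ge> 2"
    and \<delta>: "\<delta> > 0" "real (card K) \<ge> \<delta> * real (card V)"
  shows "network_gain E V K g \<ge> 1 + (1 - 1 / g) * \<delta> / 2"
proof -
  let ?d = "\<lambda>u v. real (hop_dist E u v)"
  define T where "T = (\<Sum>S\<in>V. \<Sum>D\<in>V - {S}. ?d S D)"
  define T' where "T' = (\<Sum>S\<in>V. \<Sum>D\<in>V - {S}. eff_dist E K g S D)"
  define x where "x = (1 - 1 / g) * \<delta> / 2"
  have finK: "finite K" using K fin finite_subset by blast
  have T_eq: "T = (\<Sum>S\<in>V. \<Sum>D\<in>V. ?d S D)"
    unfolding T_def by (rule sum.cong[OF refl]) (simp add: sum.remove[OF fin])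
  \<comment> \<open>The quotient is informative only for a positive denominator. A route through
    \<open>m = S\<close> has a first leg of length 0, but its second leg is then the whole
    distance.\<close>
  have pos: "eff_dist E K g S D > 0" if "S \<in> V" "D \<in> V - {S}" for S D
  proof -
    have dpos: "?d u v > 0" if "u \<in> V" "v \<in> V" "u \<noteq> v" for u v
      using hop_dist_eq_0_iff[OF components_connected[OF V that(1,2)]] that by auto
    have "?d S m / g + ?d m D > 0" if "m \<in> K" for m
    proof (cases "m = S")
      case True then show ?thesis using dpos[of S D] \<open>S \<in> V\<close> \<open>D \<in> V - {S}\<close> by auto
    next
      case False
      then have "?d S m / g > 0" using dpos[of S m] that K \<open>S \<in> V\<close> g by auto
      then show ?thesis by (simp add: add_pos_nonneg)
    qed
    then show ?thesis unfolding eff_dist_def using finK dpos[of S D] that by auto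
  qed
  have le: "eff_dist E K g S D \<le> ?d S D - of_bool (D \<in> K) * ((1 - 1 / g) * ?d S D)" for S D
  proof (cases "D \<in> K")
    case True
    then have "eff_dist E K g S D \<le> ?d S D / g + ?d D D"
      unfolding eff_dist_def using finK by (intro Min_le insertI2 image_eqI[OF refl]) auto
    then show ?thesis using True by (simp add: algebra_simps)
  next
    case False
    then show ?thesis unfolding eff_dist_def using finK by (auto intro!: Min_le)
  qed
  have "T' \<le> (\<Sum>S\<in>V. \<Sum>D\<in>V - {S}. ?d S D - of_bool (D \<in> K) * ((1 - 1 / g) * ?d S D))"
    unfolding T'_def by (intro sum_mono le)
  also have "\<dots> = T - (\<Sum>S\<in>V. \<Sum>D\<in>V - {S}. of_bool (D \<in> K) * ((1 - 1 / g) * ?d S D))"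
    by (simp add: T_def sum_subtractf)
  also have "(\<Sum>S\<in>V. \<Sum>D\<in>V - {S}. of_bool (D \<in> K) * ((1 - 1 / g) * ?d S D))
    = (\<Sum>S\<in>V. \<Sum>D\<in>K. (1 - 1 / g) * ?d S D)"
    using fin K by (intro sum.cong refl sum.mono_neutral_cong) (auto intro: finite_subset)
  also have "\<dots> = (1 - 1 / g) * (\<Sum>S\<in>V. \<Sum>k\<in>K. ?d S k)"
    by (simp add: sum_distrib_left)
  finally have T'_le: "T' \<le> T - (1 - 1 / g) * (\<Sum>S\<in>V. \<Sum>k\<in>K. ?d S k)" .
  have T0: "T \<ge> 0" unfolding T_def by (intro sum_nonneg) auto
  have "\<delta> * real (card V) * T \<le> real (card K) * T"
    using \<delta> T0 by (intro mult_right_mono)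
  also have "\<dots> \<le> 2 * real (card V) * (\<Sum>S\<in>V. \<Sum>k\<in>K. ?d S k)"
    unfolding T_eq by (rule sum_hop_dist_le_hubs[OF V K fin])
  finally have "real (card V) * (\<delta> * T) \<le> real (card V) * (2 * (\<Sum>S\<in>V. \<Sum>k\<in>K. ?d S k))"
    by (simp add: algebra_simps)
  then have "\<delta> / 2 * T \<le> (\<Sum>S\<in>V. \<Sum>k\<in>K. ?d S k)"
    using two by (subst (asm) mult_le_cancel_left) auto
  then have "(1 - 1 / g) * (\<delta> / 2 * T) \<le> (1 - 1 / g) * (\<Sum>S\<in>V. \<Sum>k\<in>K. ?d S k)"
    using g by (intro mult_left_mono) auto
  with T'_le have T'x: "T' \<le> (1 - x) * T" by (simp add: x_def algebra_simps)
  have nonempty: "V \<noteq> {}" "V - {S} \<noteq> {}" for S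
    using two card_mono[of "{S}" V] by auto
  have T'_pos: "T' > 0" unfolding T'_def
    using fin nonempty pos by (intro sum_pos) auto
  have x0: "x \<ge> 0" using g \<delta> by (simp add: x_def)
  \<comment> \<open>Multiplying by \<open>1 + x\<close> instead of dividing by \<open>1 - x\<close>
    avoids a proof that \<open>x < 1\<close>.\<close>
  have "(1 + x) * T' \<le> (1 + x) * ((1 - x) * T)" using T'x x0 by (intro mult_left_mono) auto
  also have "\<dots> = T - x\<^sup>2 * T" by (simp add: algebra_simps power2_eq_square)
  also have "\<dots> \<le> T" using T0 by simp
  finally have "1 + x \<le> T / T'" using T'_pos by (simp add: pos_le_divide_eq)
  then show ?thesis by (simp add: network_gain_def T_def T'_def x_def)
qed

subsection \<open>Components and subgraphs\<close>

definition pairs :: "'a set \<Rightarrow> 'a set set" where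
  "pairs X = {e. e \<subseteq> X \<and> card e = 2}"

text \<open>The component of \<open>v\<close> in the subgraph induced on \<open>U\<close>. Since the
  edge set is cut down to \<open>Pow U\<close>, edges leaving \<open>U\<close> do not enter at all,
  which gives independence from them.\<close>

definition reach :: "'a set set \<Rightarrow> 'a set \<Rightarrow> 'a \<Rightarrow> 'a set" where
  "reach E U v = (adj (E \<inter> Pow U))\<^sup>* `` {v}"

definition vertex_degree :: "'a set \<Rightarrow> 'a set set \<Rightarrow> 'a \<Rightarrow> real" where
  "vertex_degree X E k = (\<Sum>u\<in>X - {k}. of_bool ({k, u} \<in> E))"

text \<open>Vertices are counted, not components: merging two large components changes nothing, so
  an added edge matters only through small ones.\<close>

definition num_big :: "'a set \<Rightarrow> nat \<Rightarrow> 'a set set \<Rightarrow> real" where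
  "num_big L A E = real (card {v \<in> L. A \<le> card (reach E L v)})"

lemma finite_pairs [simp]: "finite X \<Longrightarrow> finite (pairs X)"
  by (simp add: pairs_def)

lemma pair_in_pairs: "u \<in> X \<Longrightarrow> v \<in> X \<Longrightarrow> u \<noteq> v \<Longrightarrow> {u, v} \<in> pairs X"
  by (simp add: pairs_def)

lemma reach_self [simp]: "v \<in> reach E U v"
  by (simp add: reach_def)

lemma reach_subset: "v \<in> U \<Longrightarrow> reach E U v \<subseteq> U"
  by (auto simp: reach_def dest: rtrancl_adj_in)

lemma finite_reach: "finite U \<Longrightarrow> v \<in> U \<Longrightarrow> finite (reach E U v)"
  using reach_subset finite_subset by metis

lemma reach_eq:
  assumes "x \<in> reach E U v"
  shows "reach E U x = reach E U v"
proof -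
  have vx: "(v, x) \<in> (adj (E \<inter> Pow U))\<^sup>*" using assms by (simp add: reach_def)
  then have "(x, v) \<in> (adj (E \<inter> Pow U))\<^sup>*" by (rule symD[OF sym_rtrancl_adj])
  with vx show ?thesis unfolding reach_def by (blast intro: rtrancl_trans)
qed

lemma reach_mono: "E \<subseteq> E' \<Longrightarrow> U \<subseteq> U' \<Longrightarrow> reach E U v \<subseteq> reach E' U' v"
  unfolding reach_def by (intro Image_mono rtrancl_mono) (auto simp: adj_def)

text \<open>One exploration step. After deletion of \<open>v\<close> its component falls into
  pieces, each containing a neighbour of \<open>v\<close>; several neighbours may share a piece,
  hence only an inequality. The pieces do not depend on the edges at \<open>v\<close>.\<close>

lemma card_reach_le:
  assumes "finite U" "v \<in> U"
  shows "real (card (reach E U v))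
    \<le> 1 + (\<Sum>u\<in>U - {v}. of_bool ({v, u} \<in> E) * real (card (reach E (U - {v}) u)))"
proof -
  define N where "N = {u \<in> U - {v}. {v, u} \<in> E}"
  \<comment> \<open>Induction along the walk, restarted at every return to \<open>v\<close>: the
    witness \<open>u\<close> is the vertex entered after the last visit to \<open>v\<close>.\<close>
  have "x = v \<or> (\<exists>u\<in>N. x \<in> reach E (U - {v}) u)" if "(v, x) \<in> (adj (E \<inter> Pow U))\<^sup>*" for x
    using that
  proof (induction rule: rtrancl_induct)
    case (step x y)
    consider "y = v" | "y \<noteq> v" "x = v" | "y \<noteq> v" "x \<noteq> v" by auto
    then show ?case
    proof cases
      case 2
      then show ?thesis using step.hyps
        by (intro disjI2 bexI[of _ y]) (auto simp: N_def adj_iff)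
    next
      case 3
      then obtain u where u: "u \<in> N" "(u, x) \<in> (adj (E \<inter> Pow (U - {v})))\<^sup>*"
        using step.IH by (auto simp: reach_def)
      moreover have "(x, y) \<in> adj (E \<inter> Pow (U - {v}))"
        using step.hyps 3 by (auto simp: adj_iff)
      ultimately show ?thesis by (auto simp: reach_def intro: rtrancl_into_rtrancl)
    qed simp
  qed simp
  then have "reach E U v \<subseteq> insert v (\<Union>u\<in>N. reach E (U - {v}) u)"
    by (auto simp: reach_def[of E U])
  moreover have fin: "finite N" "finite (\<Union>u\<in>N. reach E (U - {v}) u)"
    using assms by (auto simp: N_def intro!: finite_reach)
  ultimately have "card (reach E U v) \<le> card (insert v (\<Union>u\<in>N. reach E (U - {v}) u))"
    by (intro card_mono) auto
  also have "\<dots> \<le> Suc (card (\<Union>u\<in>N. reach E (U - {v}) u))" by (rule card_insert_le_m1) auto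
  also have "card (\<Union>u\<in>N. reach E (U - {v}) u) \<le> (\<Sum>u\<in>N. card (reach E (U - {v}) u))"
    by (rule card_UN_le[OF fin(1)])
  finally have "real (card (reach E U v)) \<le> 1 + (\<Sum>u\<in>N. real (card (reach E (U - {v}) u)))"
    by (simp flip: of_nat_sum)
  also have "(\<Sum>u\<in>N. real (card (reach E (U - {v}) u)))
    = (\<Sum>u\<in>U - {v}. of_bool ({v, u} \<in> E) * real (card (reach E (U - {v}) u)))"
    using assms by (intro sum.mono_neutral_cong_left) (auto simp: N_def)
  finally show ?thesis .
qed

text \<open>
  The bound \<open>\<chi> v = 1 + w v * s / (1 - \<nu>)\<close> on the expected component size is the fixed point of the
  branching recursion \<open>\<chi> v = 1 + (\<Sum>u. q {v, u} * \<chi> u)\<close>.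
\<close>

lemma expect_card_reach_le:
  fixes w :: "'a \<Rightarrow> real"
  assumes "finite P" "\<And>e. e \<in> P \<Longrightarrow> 0 \<le> q e \<and> q e \<le> 1"
    and "\<And>u v. u \<in> L \<Longrightarrow> v \<in> L \<Longrightarrow> u \<noteq> v \<Longrightarrow> {u, v} \<in> P \<and> q {u, v} \<le> w u * w v * \<rho>"
    and "finite L" and w: "\<And>u. u \<in> L \<Longrightarrow> 0 \<le> w u" and "0 \<le> \<rho>"
    and s: "\<rho> * (\<Sum>u\<in>L. w u) \<le> s" and \<nu>: "\<rho> * (\<Sum>u\<in>L. (w u)\<^sup>2) \<le> \<nu>" "\<nu> < 1"
    and "v \<in> U" "U \<subseteq> L"
  shows "expect P q (\<lambda>E. real (card (reach E U v))) \<le> 1 + w v * (s / (1 - \<nu>))"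
proof -
  define \<kappa> where "\<kappa> = s / (1 - \<nu>)"
  have "0 \<le> \<rho> * (\<Sum>u\<in>L. w u)" using w \<open>0 \<le> \<rho>\<close> by (intro mult_nonneg_nonneg sum_nonneg) auto
  then have \<kappa>0: "\<kappa> \<ge> 0" using s \<nu> by (simp add: \<kappa>_def)
  have \<kappa>_eq: "s + \<nu> * \<kappa> = \<kappa>" using \<nu> by (simp add: \<kappa>_def field_simps)
  have finU: "finite U" using \<open>U \<subseteq> L\<close> \<open>finite L\<close> finite_subset by blast
  then show ?thesis using \<open>v \<in> U\<close> \<open>U \<subseteq> L\<close> unfolding \<kappa>_def[symmetric]
  proof (induction U arbitrary: v rule: finite_psubset_induct)
    \<comment> \<open>Removing \<open>v\<close> shrinks \<open>U\<close>, while \<open>s\<close> and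
      \<open>\<nu>\<close> bound sums over the fixed set \<open>L\<close>, so one constant
      \<open>\<kappa>\<close> serves at every stage.\<close>
    case (psubset U)
    let ?U = "U - {v}"
    have L: "v \<in> L" "\<And>u. u \<in> ?U \<Longrightarrow> u \<in> L" using psubset.prems by auto
    have "expect P q (\<lambda>E. real (card (reach E U v)))
      \<le> expect P q (\<lambda>E. 1 + (\<Sum>u\<in>?U. of_bool ({v, u} \<in> E) * real (card (reach E ?U u))))"
      using psubset by (intro expect_mono assms card_reach_le) auto
    also have "\<dots> = 1 + (\<Sum>u\<in>?U. expect P q (\<lambda>E. of_bool ({v, u} \<in> E) * real (card (reach E ?U u))))"
      using assms(1) by (simp add: Bochner_Integration.integral_add Bochner_Integration.integral_sum)
    also have "(\<Sum>u\<in>?U. expect P q (\<lambda>E. of_bool ({v, u} \<in> E) * real (card (reach E ?U u))))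
      = (\<Sum>u\<in>?U. q {v, u} * expect P q (\<lambda>E. real (card (reach E ?U u))))"
    proof (intro sum.cong refl expect_edge_indep)
      fix u assume u: "u \<in> ?U"
      then have *: "{v, u} \<in> P" using assms(3)[of v u] L by auto
      show "finite P" "{v, u} \<in> P" "0 \<le> q {v, u}" "q {v, u} \<le> 1" using assms * by auto
      have "insert {v, u} E \<inter> Pow ?U = E \<inter> Pow ?U" for E by auto
      then show "real (card (reach (insert {v, u} E) ?U u)) = real (card (reach E ?U u))" for E
        by (simp add: reach_def)
    qed
    also have "\<dots> \<le> (\<Sum>u\<in>?U. (w v * w u * \<rho>) * (1 + w u * \<kappa>))"
    proof (intro sum_mono mult_mono)
      fix u assume u: "u \<in> ?U"
      show "q {v, u} \<le> w v * w u * \<rho>" using assms(3)[of v u] L u by auto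
      show "expect P q (\<lambda>E. real (card (reach E ?U u))) \<le> 1 + w u * \<kappa>"
        using u psubset.prems by (intro psubset.IH) auto
      show "0 \<le> w v * w u * \<rho>" using w L u \<open>0 \<le> \<rho>\<close> by simp
    qed simp
    also have "\<dots> = w v * (\<rho> * (\<Sum>u\<in>?U. w u) + \<rho> * (\<Sum>u\<in>?U. (w u)\<^sup>2) * \<kappa>)"
      by (simp add: sum_distrib_left sum_distrib_right sum.distrib[symmetric] algebra_simps power2_eq_square)
    also have "\<dots> \<le> w v * (s + \<nu> * \<kappa>)"
    proof (intro mult_left_mono add_mono mult_right_mono)
      have "\<rho> * (\<Sum>u\<in>?U. w u) \<le> \<rho> * (\<Sum>u\<in>L. w u)" "\<rho> * (\<Sum>u\<in>?U. (w u)\<^sup>2) \<le> \<rho> * (\<Sum>u\<in>L. (w u)\<^sup>2)"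
        using L w \<open>0 \<le> \<rho>\<close> \<open>finite L\<close> by (auto intro!: mult_left_mono sum_mono2)
      then show "\<rho> * (\<Sum>u\<in>?U. w u) \<le> s" "\<rho> * (\<Sum>u\<in>?U. (w u)\<^sup>2) \<le> \<nu>" using s \<nu> by auto
    qed (use w L \<kappa>0 in auto)
    finally show ?case using \<kappa>_eq by simp
  qed
qed

text \<open>Up to the first use of the new edge a walk runs in the old graph and ends at one of its
  endpoints.\<close>

lemma rtrancl_adj_insert:
  assumes "(v, x) \<in> (adj (insert {a, b} E))\<^sup>*"
  shows "(v, x) \<in> (adj E)\<^sup>* \<or> (v, a) \<in> (adj E)\<^sup>* \<or> (v, b) \<in> (adj E)\<^sup>*"
  using assms
proof (induction rule: rtrancl_induct)
  case (step x y)
  then consider "(x, y) \<in> adj E" | "x = a" | "x = b" by (auto simp: adj_iff doubleton_eq_iff)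
  then show ?case using step.IH by cases (auto intro: rtrancl_into_rtrancl)
qed simp

text \<open>Adding an edge only enlarges components. A vertex that becomes counted lay in a
  component of size below \<open>A\<close> containing an endpoint of \<open>e\<close>, and each of
  the two endpoints accounts for at most \<open>A\<close> such vertices.\<close>

lemma num_big_lipschitz:
  assumes "finite L" "card e = 2"
  shows "\<bar>num_big L A (insert e E) - num_big L A E\<bar> \<le> 2 * real A"
proof (cases "e \<subseteq> L")
  case False
  then have "insert e E \<inter> Pow L = E \<inter> Pow L" by auto
  then show ?thesis by (simp add: num_big_def reach_def)
next
  case True
  then obtain a b where e: "e = {a, b}" "a \<in> L" "b \<in> L" using assms by (auto simp: card_2_iff)
  define S where "S = (\<lambda>E. {v \<in> L. A \<le> card (reach E L v)})"
  define R where "R = (\<lambda>x. if card (reach E L x) < A then reach E L x else {})"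
  have "card (reach E L v) \<le> card (reach (insert e E) L v)" if "v \<in> L" for v
    using that assms(1) by (intro card_mono finite_reach reach_mono) auto
  then have "S E \<subseteq> S (insert e E)" by (force simp: S_def)
  then have 1: "card (S E) \<le> card (S (insert e E))"
    using assms(1) by (intro card_mono) (auto simp: S_def)
  have "S (insert e E) \<subseteq> S E \<union> (R a \<union> R b)"
  proof
    fix v assume v: "v \<in> S (insert e E)"
    show "v \<in> S E \<union> (R a \<union> R b)"
    proof (cases "v \<in> S E")
      case False
      then have "reach (insert e E) L v \<noteq> reach E L v" "card (reach E L v) < A"
        using v by (auto simp: S_def)
      moreover have "reach E L v \<subseteq> reach (insert e E) L v" by (intro reach_mono) auto
      ultimately obtain x where "x \<in> reach (insert e E) L v" "x \<notin> reach E L v" by auto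
      moreover have "insert e E \<inter> Pow L = insert {a, b} (E \<inter> Pow L)" using True e by auto
      ultimately have "a \<in> reach E L v \<or> b \<in> reach E L v"
        using rtrancl_adj_insert[of v x a b "E \<inter> Pow L"] by (auto simp: reach_def)
      then obtain c where c: "c = a \<or> c = b" "c \<in> reach E L v" by auto
      from reach_eq[OF c(2)] have "v \<in> R c"
        using \<open>card (reach E L v) < A\<close> by (simp add: R_def)
      then show ?thesis using c(1) by blast
    qed simp
  qed
  moreover have "finite (S E \<union> (R a \<union> R b))" using assms e by (auto simp: S_def R_def finite_reach)
  ultimately have "card (S (insert e E)) \<le> card (S E \<union> (R a \<union> R b))" by (rule card_mono[rotated])
  also have "\<dots> \<le> card (S E) + (card (R a) + card (R b))"
    by (meson add_left_mono card_Un_le order_trans)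
  also have "\<dots> \<le> card (S E) + (A + A)" by (intro add_mono) (auto simp: R_def)
  finally show ?thesis using 1 by (simp add: num_big_def S_def)
qed

lemma degree_lipschitz:
  assumes "finite X" "card e = 2"
  shows "\<bar>vertex_degree X (insert e E) k - vertex_degree X E k\<bar> \<le> of_bool (k \<in> e)"
proof (cases "k \<in> e")
  case False
  then have "{k, u} \<noteq> e" for u by auto
  then show ?thesis by (simp add: vertex_degree_def)
next
  case True
  then obtain b where e: "e = {k, b}" "b \<noteq> k" using assms by (auto simp: card_2_iff)
  have "vertex_degree X (insert e E) k - vertex_degree X E k
    = (\<Sum>u\<in>X - {k}. of_bool (u = b) * of_bool ({k, b} \<notin> E))"
    unfolding vertex_degree_def sum_subtractf[symmetric]
    by (intro sum.cong) (auto simp: e doubleton_eq_iff)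
  also have "\<dots> = of_bool (b \<in> X) * of_bool ({k, b} \<notin> E)"
    using assms(1) e by (simp add: sum_distrib_right[symmetric] of_bool_def sum.delta)
  finally show ?thesis using True by auto
qed

text \<open>A component avoiding \<open>C\<close> has no core vertex to charge its vertices to; it
  is then a component of the graph on \<open>X - C\<close>, and \<open>A \<le> card V\<close> puts
  all of it into \<open>num_big\<close>.\<close>

lemma card_component_le:
  assumes "finite X" "E \<subseteq> pairs X" "V \<in> components X E" "C \<subseteq> X" "A \<le> card V"
  shows "real (card V) \<le> real (card (V \<inter> C)) + real A * (\<Sum>k\<in>V \<inter> C. vertex_degree X E k) + num_big (X - C) A E"
proof -
  define L where "L = X - C"
  define big where "big = {v \<in> L. A \<le> card (reach E L v)}"
  have VX: "V \<subseteq> X" using assms(2) by (intro components_subset[OF _ assms(3)]) (auto simp: pairs_def)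
  then have fin: "finite V" "finite L" "finite big" using assms(1) by (auto simp: L_def big_def finite_subset)
  have nb: "num_big (X - C) A E = real (card big)" by (simp add: num_big_def big_def L_def)
  show ?thesis
  proof (cases "V \<inter> C = {}")
    case True
    then have "V \<subseteq> L" using VX by (auto simp: L_def)
    have "V \<subseteq> big"
    proof
      fix v assume v: "v \<in> V"
      have "(v, x) \<in> (adj (E \<inter> Pow L))\<^sup>*" if "(v, x) \<in> (adj E)\<^sup>*" for x
        using that
      proof (induction rule: rtrancl_induct)
        case (step x y)
        have "x \<in> V" "y \<in> V"
          using components_closed[OF assms(3) v] step.hyps by (auto intro: rtrancl_into_rtrancl)
        then have "(x, y) \<in> adj (E \<inter> Pow L)" using step.hyps \<open>V \<subseteq> L\<close> by (auto simp: adj_iff)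
        then show ?case using step.IH by (rule rtrancl_into_rtrancl[rotated])
      qed simp
      then have "V \<subseteq> reach E L v"
        using components_connected[OF assms(3) v] by (auto simp: reach_def)
      then have "card V \<le> card (reach E L v)"
        using v \<open>V \<subseteq> L\<close> fin by (intro card_mono finite_reach) auto
      then show "v \<in> big" using v \<open>V \<subseteq> L\<close> assms(5) by (auto simp: big_def)
    qed
    then have "card V \<le> card big" using fin by (intro card_mono)
    then show ?thesis using True by (simp add: nb)
  next
    case False
    then obtain k where k: "k \<in> V" "k \<in> C" by auto
    define N where "N = (\<lambda>k. {u \<in> X - {k}. {k, u} \<in> E})"
    define R where "R = (\<lambda>u. if card (reach E L u) < A \<and> u \<in> L then reach E L u else {})"
    \<comment> \<open>If the walk ends outside \<open>C\<close>, then \<open>k'\<close> is its last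
      vertex in \<open>C\<close> and \<open>u\<close> the successor of \<open>k'\<close>.\<close>
    have path: "x \<in> C \<or> (\<exists>k'\<in>V \<inter> C. \<exists>u\<in>N k'. u \<in> L \<and> x \<in> reach E L u)"
      if "(k, x) \<in> (adj E)\<^sup>*" for x
      using that
    proof (induction rule: rtrancl_induct)
      case (step x y)
      have xy: "x \<in> V" "y \<in> V"
        using components_closed[OF assms(3) k(1)] step.hyps by (auto intro: rtrancl_into_rtrancl)
      have E: "{x, y} \<in> E" "{x, y} \<in> pairs X" using step.hyps assms(2) by (auto simp: adj_iff)
      consider "y \<in> C" | "y \<in> L" "x \<in> C" | "y \<in> L" "x \<in> L" using xy VX by (auto simp: L_def)
      then show ?case
      proof cases
        case 2
        then have "y \<in> N x" using E xy VX by (auto simp: N_def pairs_def)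
        then show ?thesis using 2 xy by (intro disjI2 bexI[of _ x] bexI[of _ y]) auto
      next
        case 3
        then obtain k' u where "k' \<in> V \<inter> C" "u \<in> N k'" "u \<in> L" "x \<in> reach E L u"
          using step.IH by (auto simp: L_def)
        moreover have "y \<in> reach E L u"
          using \<open>x \<in> reach E L u\<close> 3 E by (auto simp: reach_def adj_iff intro: rtrancl_into_rtrancl)
        ultimately show ?thesis by auto
      qed simp
    qed (use k in simp)
    have "V \<subseteq> (V \<inter> C) \<union> ((\<Union>k\<in>V \<inter> C. \<Union>u\<in>N k. R u) \<union> big)"
    proof
      fix x assume x: "x \<in> V"
      show "x \<in> (V \<inter> C) \<union> ((\<Union>k\<in>V \<inter> C. \<Union>u\<in>N k. R u) \<union> big)"
      proof (cases "x \<in> C")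
        case False
        then obtain k' u where u: "k' \<in> V \<inter> C" "u \<in> N k'" "u \<in> L" "x \<in> reach E L u"
          using path[OF components_connected[OF assms(3) k(1) x]] by auto
        have "x \<in> big" if "\<not> card (reach E L u) < A"
          using that reach_eq[OF u(4)] reach_subset[OF u(3)] u(4) by (auto simp: big_def)
        then show ?thesis using u by (auto simp: R_def)
      qed (use x in simp)
    qed
    moreover have finN: "finite (N k)" for k using assms(1) by (simp add: N_def)
    moreover have finR: "finite (R u)" for u using fin by (simp add: R_def finite_reach)
    ultimately have "card V \<le> card ((V \<inter> C) \<union> ((\<Union>k\<in>V \<inter> C. \<Union>u\<in>N k. R u) \<union> big))"
      using fin by (intro card_mono) auto
    also have "\<dots> \<le> card (V \<inter> C) + (card (\<Union>k\<in>V \<inter> C. \<Union>u\<in>N k. R u) + card big)"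
      by (meson add_left_mono card_Un_le order_trans)
    also have "card (\<Union>k\<in>V \<inter> C. \<Union>u\<in>N k. R u) \<le> (\<Sum>k\<in>V \<inter> C. card (\<Union>u\<in>N k. R u))"
      using fin by (intro card_UN_le) auto
    also have "\<dots> \<le> (\<Sum>k\<in>V \<inter> C. \<Sum>u\<in>N k. card (R u))"
      by (intro sum_mono card_UN_le finN)
    also have "\<dots> \<le> (\<Sum>k\<in>V \<inter> C. \<Sum>u\<in>N k. A)"
      by (intro sum_mono) (auto simp: R_def)
    also have "\<dots> = (\<Sum>k\<in>V \<inter> C. card (N k)) * A" by (simp add: sum_distrib_right)
    finally have "real (card V) \<le> real (card (V \<inter> C) + ((\<Sum>k\<in>V \<inter> C. card (N k)) * A + card big))"
      by (simp only: of_nat_le_iff)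
    moreover have "vertex_degree X E k = real (card (N k))" for k
      using assms(1) by (simp add: vertex_degree_def N_def of_bool_def sum.If_cases Int_def)
    ultimately show ?thesis by (simp add: nb mult.commute)
  qed
qed

text \<open>If every component met less than a third of \<open>B\<close>, take a smallest family of
  components covering at least a third of \<open>B\<close>. Without one of its members it covers
  less than a third, so it covers less than two thirds in all. What is left of \<open>B\<close> is
  more than a third, yet no edge joins it to the family.\<close>

lemma exists_large_component:
  assumes "finite X" "B \<subseteq> X" "B \<noteq> {}"
    and edge: "\<And>P Q. P \<subseteq> B \<Longrightarrow> Q \<subseteq> B \<Longrightarrow> P \<inter> Q = {} \<Longrightarrow> card B \<le> 3 * card P \<Longrightarrow> card B \<le> 3 * card Q
      \<Longrightarrow> \<exists>p\<in>P. \<exists>q\<in>Q. {p, q} \<in> E"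
  shows "\<exists>V\<in>components X E. card B \<le> 3 * card (V \<inter> B)"
proof (rule ccontr)
  assume "\<not> ?thesis"
  then have small: "3 * card (V \<inter> B) < card B" if "V \<in> components X E" for V using that by force
  have finB: "finite B" using assms finite_subset by blast
  define ok where "ok = (\<lambda>D. D \<subseteq> components X E \<and> card B \<le> 3 * card (\<Union>D \<inter> B))"
  have "X \<subseteq> \<Union>(components X E)" by (auto simp: components_def)
  then have "\<Union>(components X E) \<inter> B = B" using assms(2) by auto
  then have "ok (components X E)" by (simp add: ok_def)
  then obtain D where D: "ok D" "\<And>D'. ok D' \<Longrightarrow> card D \<le> card D'"
    using ex_has_least_nat[of ok "components X E" card] by blast
  have finD: "finite D" using D(1) assms(1) by (auto simp: ok_def components_def dest: finite_subset)
  have "card B > 0" using finB assms(3) by (simp add: card_gt_0_iff)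
  then have "D \<noteq> {}" using D(1) by (auto simp: ok_def)
  then obtain V where V: "V \<in> D" by auto
  have "card (D - {V}) < card D" using V finD by (intro psubset_card_mono) auto
  then have "\<not> ok (D - {V})" using D(2) by force
  then have "3 * card (\<Union>(D - {V}) \<inter> B) < card B" using D(1) by (auto simp: ok_def)
  moreover have "card (\<Union>D \<inter> B) \<le> card (\<Union>(D - {V}) \<inter> B) + card (V \<inter> B)"
    using V finB by (intro order.trans[OF card_mono card_Un_le]) auto
  moreover have "3 * card (V \<inter> B) < card B" using small V D(1) by (auto simp: ok_def)
  moreover have "card B = card (\<Union>D \<inter> B) + card (B - \<Union>D)"
    using finB card_Int_Diff[of B "\<Union>D"] by (simp add: Int_commute)
  ultimately have "card B \<le> 3 * card (B - \<Union>D)" by linarith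
  moreover have "card B \<le> 3 * card (\<Union>D \<inter> B)" using D(1) by (simp add: ok_def)
  ultimately obtain p r where pr: "p \<in> \<Union>D \<inter> B" "r \<in> B - \<Union>D" "{p, r} \<in> E"
    using edge[of "\<Union>D \<inter> B" "B - \<Union>D"] by auto
  then obtain V' where V': "V' \<in> D" "p \<in> V'" by auto
  then have "r \<in> V'"
    using components_closed[of V' X E p r] pr D(1) by (auto simp: ok_def adj_iff r_into_rtrancl)
  then show False using V' pr by auto
qed

subsection \<open>Graphs with given expected degrees\<close>

text \<open>The Chung-Lu model for arbitrary positive weights. The product over \<open>e\<close>
  makes \<open>q\<close> a function of the unordered pair; it is required to be at most 1 on
  \<open>pairs X\<close> only.\<close>

locale expected_degrees =
  fixes X :: "'a set" and w :: "'a \<Rightarrow> real" and \<rho> :: real and q :: "'a set \<Rightarrow> real"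
  assumes finite_X: "finite X" and X_nonempty: "X \<noteq> {}"
    and w_pos: "\<And>u. u \<in> X \<Longrightarrow> 0 < w u"
    and \<rho>_eq: "\<rho> = 1 / (\<Sum>u\<in>X. w u)"
    and q_eq: "\<And>e. q e = (\<Prod>u\<in>e. w u) * \<rho>"
    and q_le_1: "\<And>e. e \<in> pairs X \<Longrightarrow> q e \<le> 1"
begin

lemma sum_w_pos: "0 < (\<Sum>u\<in>X. w u)"
  using finite_X X_nonempty w_pos by (intro sum_pos) auto

lemma \<rho>_pos: "0 < \<rho>"
  using sum_w_pos by (simp add: \<rho>_eq)

lemma \<rho>_sum_w: "\<rho> * (\<Sum>u\<in>X. w u) = 1"
  using sum_w_pos by (simp add: \<rho>_eq)

lemma q_pair: "u \<noteq> v \<Longrightarrow> q {u, v} = w u * w v * \<rho>"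
  by (simp add: q_eq)

lemma q_bounds:
  assumes "e \<in> pairs X"
  shows "0 \<le> q e \<and> q e \<le> 1"
proof -
  have "0 \<le> (\<Prod>u\<in>e. w u)"
    using assms w_pos by (intro prod_nonneg) (auto simp: pairs_def intro: less_imp_le)
  then show ?thesis using q_le_1[OF assms] \<rho>_pos by (simp add: q_eq)
qed

text \<open>The expected degree falls short of \<open>w k\<close> exactly by the loop term
  \<open>(w k)\<^sup>2 * \<rho>\<close>.\<close>

lemma sum_q_neighbours: "k \<in> X \<Longrightarrow> (\<Sum>u\<in>X - {k}. q {k, u}) \<le> w k"
proof -
  assume k: "k \<in> X"
  have "(\<Sum>u\<in>X - {k}. q {k, u}) = w k * (\<rho> * (\<Sum>u\<in>X - {k}. w u))"
    unfolding sum_distrib_left by (intro sum.cong refl, subst q_pair) auto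
  also have "\<dots> \<le> w k * (\<rho> * (\<Sum>u\<in>X. w u))"
    using k finite_X w_pos \<rho>_pos by (intro mult_left_mono sum_mono2) (auto intro: less_imp_le)
  finally show ?thesis by (simp add: \<rho>_sum_w)
qed

lemma sum_q_incident: "k \<in> X \<Longrightarrow> (\<Sum>e\<in>pairs X. of_bool (k \<in> e) * q e) \<le> w k"
proof -
  assume k: "k \<in> X"
  have "{e \<in> pairs X. k \<in> e} = (\<lambda>u. {k, u}) ` (X - {k})"
  proof (intro equalityI subsetI)
    fix e assume "e \<in> {e \<in> pairs X. k \<in> e}"
    then show "e \<in> (\<lambda>u. {k, u}) ` (X - {k})" by (auto simp: pairs_def card_2_iff)
  qed (use k in \<open>auto intro: pair_in_pairs\<close>)
  moreover have "inj_on (\<lambda>u. {k, u}) (X - {k})" by (auto simp: inj_on_def doubleton_eq_iff)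
  moreover have "(\<Sum>e\<in>pairs X. of_bool (k \<in> e) * q e) = (\<Sum>e\<in>{e \<in> pairs X. k \<in> e}. q e)"
    using finite_X by (intro sum.mono_neutral_cong_right) auto
  ultimately have "(\<Sum>e\<in>pairs X. of_bool (k \<in> e) * q e) = (\<Sum>u\<in>X - {k}. q {k, u})"
    by (simp add: sum.reindex)
  then show ?thesis using sum_q_neighbours[OF k] by simp
qed

text \<open>This is the expected number of edges, the quantity in the variance bounds. Summing over
  both endpoints of an edge loses a factor 2, which is harmless.\<close>

lemma sum_q_le: "(\<Sum>e\<in>pairs X. q e) \<le> (\<Sum>u\<in>X. w u)"
proof -
  have "(\<Sum>e\<in>pairs X. q e) \<le> (\<Sum>e\<in>pairs X. \<Sum>k\<in>X. of_bool (k \<in> e) * q e)"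
  proof (intro sum_mono)
    fix e assume e: "e \<in> pairs X"
    then obtain k where "k \<in> e" "k \<in> X" by (auto simp: pairs_def card_2_iff)
    then have "of_bool (k \<in> e) * q e \<le> (\<Sum>k\<in>X. of_bool (k \<in> e) * q e)"
      using finite_X q_bounds[OF e] by (intro member_le_sum) auto
    then show "q e \<le> (\<Sum>k\<in>X. of_bool (k \<in> e) * q e)" using \<open>k \<in> e\<close> by simp
  qed
  also have "\<dots> = (\<Sum>k\<in>X. \<Sum>e\<in>pairs X. of_bool (k \<in> e) * q e)" by (rule sum.swap)
  also have "\<dots> \<le> (\<Sum>u\<in>X. w u)" by (intro sum_mono sum_q_incident)
  finally show ?thesis .
qed

lemma expect_degree_le:
  assumes "k \<in> X"
  shows "expect (pairs X) q (\<lambda>E. vertex_degree X E k) \<le> w k"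
proof -
  have "expect (pairs X) q (\<lambda>E. of_bool ({k, u} \<in> E)) = q {k, u}" if "u \<in> X - {k}" for u
    using expect_edge_indep[of "pairs X" "{k, u}" q "\<lambda>_. 1"] that assms finite_X
      q_bounds[of "{k, u}"] pair_in_pairs[of k X u] by auto
  moreover have "expect (pairs X) q (\<lambda>E. vertex_degree X E k)
    = (\<Sum>u\<in>X - {k}. expect (pairs X) q (\<lambda>E. of_bool ({k, u} \<in> E)))"
    unfolding vertex_degree_def using finite_X by (intro Bochner_Integration.integral_sum) auto
  ultimately have "expect (pairs X) q (\<lambda>E. vertex_degree X E k) = (\<Sum>u\<in>X - {k}. q {k, u})"
    by simp
  then show ?thesis using sum_q_neighbours[OF assms] by simp
qed

lemma variance_degree_le:
  assumes "k \<in> X"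
  shows "measure_pmf.variance (random_edges (pairs X) q) (\<lambda>E. vertex_degree X E k) \<le> w k"
proof -
  have "measure_pmf.variance (random_edges (pairs X) q) (\<lambda>E. vertex_degree X E k)
    \<le> (\<Sum>e\<in>pairs X. (of_bool (k \<in> e))\<^sup>2 * q e)"
    using finite_X q_bounds
    by (intro variance_le_lipschitz degree_lipschitz) (auto simp: pairs_def)
  also have "\<dots> = (\<Sum>e\<in>pairs X. of_bool (k \<in> e) * q e)" by (intro sum.cong) auto
  also have "\<dots> \<le> w k" by (rule sum_q_incident[OF assms])
  finally show ?thesis .
qed

text \<open>The variance of a degree is at most its weight, and a parabola around the mean dominates
  the excess over \<open>a\<close>. The resulting bound tends to 0 as \<open>a\<close> grows with
  \<open>t\<close> fixed.\<close>

lemma expect_excess_degree_le: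
  assumes k: "k \<in> X" and wk: "w k \<le> t" "t < a"
  shows "expect (pairs X) q (\<lambda>E. max (vertex_degree X E k - a) 0) \<le> t / (4 * (a - t))"
proof -
  define m where "m = expect (pairs X) q (\<lambda>E. vertex_degree X E k)"
  have m: "m \<le> w k" unfolding m_def by (rule expect_degree_le[OF k])
  then have am: "a - t \<le> a - m" "0 < a - m" using wk by auto
  have pt: "max (d - a) 0 \<le> (d - m)\<^sup>2 / (4 * (a - m))" for d
  proof -
    \<comment> \<open>The line \<open>d - a\<close> is tangent to the parabola
      \<open>(d - m)\<^sup>2 / (4 * (a - m))\<close> at \<open>d = 2 * a - m\<close>.\<close>
    have "0 \<le> ((d - m) - 2 * (a - m))\<^sup>2" by simp
    then have "(d - a) * (4 * (a - m)) \<le> (d - m)\<^sup>2"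
      by (simp add: power2_eq_square algebra_simps)
    then have "d - a \<le> (d - m)\<^sup>2 / (4 * (a - m))" using am by (subst pos_le_divide_eq) auto
    then show ?thesis using am by simp
  qed
  have "expect (pairs X) q (\<lambda>E. max (vertex_degree X E k - a) 0)
    \<le> expect (pairs X) q (\<lambda>E. (vertex_degree X E k - m)\<^sup>2 / (4 * (a - m)))"
    using finite_X pt by (intro expect_mono) auto
  also have "\<dots> = measure_pmf.variance (random_edges (pairs X) q) (\<lambda>E. vertex_degree X E k) / (4 * (a - m))"
    unfolding m_def by (rule integral_divide_zero)
  also have "\<dots> \<le> t / (4 * (a - t))"
    using variance_degree_le[OF k] wk am w_pos[OF k] by (intro frac_le) auto
  finally show ?thesis .
qed

text \<open>Split at weight \<open>t\<close>: light vertices are handled by the variance, while for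
  heavy ones, whose mean degree may itself exceed \<open>a\<close>, the whole expected degree is
  given away.\<close>

lemma expect_sum_excess_degree_le:
  assumes C: "C \<subseteq> X" and t: "0 \<le> t" "t < a"
  shows "expect (pairs X) q (\<lambda>E. \<Sum>k\<in>C. max (vertex_degree X E k - a) 0)
    \<le> real (card X) * (t / (4 * (a - t))) + (\<Sum>k\<in>{k \<in> X. t < w k}. w k)"
proof -
  have deg0: "vertex_degree X E k \<ge> 0" for E k by (auto simp: vertex_degree_def intro: sum_nonneg)
  have finC: "finite C" using C finite_X finite_subset by blast
  have "expect (pairs X) q (\<lambda>E. \<Sum>k\<in>C. max (vertex_degree X E k - a) 0)
    = (\<Sum>k\<in>C. expect (pairs X) q (\<lambda>E. max (vertex_degree X E k - a) 0))"
    using finite_X by (intro Bochner_Integration.integral_sum) auto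
  also have "\<dots> \<le> (\<Sum>k\<in>C. t / (4 * (a - t)) + of_bool (t < w k) * w k)"
  proof (intro sum_mono)
    fix k assume "k \<in> C"
    then have k: "k \<in> X" using C by auto
    show "expect (pairs X) q (\<lambda>E. max (vertex_degree X E k - a) 0) \<le> t / (4 * (a - t)) + of_bool (t < w k) * w k"
    proof (cases "t < w k")
      case False
      then show ?thesis using expect_excess_degree_le[OF k _ t(2)] by simp
    next
      case True
      have "expect (pairs X) q (\<lambda>E. max (vertex_degree X E k - a) 0) \<le> expect (pairs X) q (\<lambda>E. vertex_degree X E k)"
        using finite_X deg0 t by (intro expect_mono) (auto simp: max_def)
      also have "\<dots> \<le> w k" by (rule expect_degree_le[OF k])
      finally show ?thesis using True t by (simp add: add_increasing)
    qed
  qed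
  also have "\<dots> \<le> (\<Sum>k\<in>X. t / (4 * (a - t)) + of_bool (t < w k) * w k)"
    using finite_X C t w_pos by (intro sum_mono2) (auto intro!: add_nonneg_nonneg less_imp_le)
  also have "\<dots> = real (card X) * (t / (4 * (a - t))) + (\<Sum>k\<in>X. of_bool (t < w k) * w k)"
    by (simp add: sum.distrib)
  also have "(\<Sum>k\<in>X. of_bool (t < w k) * w k) = (\<Sum>k\<in>{k \<in> X. t < w k}. w k)"
    using finite_X by (intro sum.mono_neutral_cong_right) auto
  finally show ?thesis .
qed

lemma sum_excess_degree_lipschitz:
  assumes "C \<subseteq> X" "e \<in> pairs X"
  shows "\<bar>(\<Sum>k\<in>C. max (vertex_degree X (insert e E) k - a) 0) - (\<Sum>k\<in>C. max (vertex_degree X E k - a) 0)\<bar> \<le> 2"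
proof -
  have e: "card e = 2" "finite e" using assms(2) by (auto simp: pairs_def card_ge_0_finite)
  have finC: "finite C" using assms finite_X finite_subset by blast
  have "\<bar>(\<Sum>k\<in>C. max (vertex_degree X (insert e E) k - a) 0) - (\<Sum>k\<in>C. max (vertex_degree X E k - a) 0)\<bar>
    \<le> (\<Sum>k\<in>C. \<bar>max (vertex_degree X (insert e E) k - a) 0 - max (vertex_degree X E k - a) 0\<bar>)"
    unfolding sum_subtractf[symmetric] by (rule sum_abs)
  also have "\<dots> \<le> (\<Sum>k\<in>C. of_bool (k \<in> e))"
  proof (intro sum_mono)
    fix k
    have "\<bar>max (vertex_degree X (insert e E) k - a) 0 - max (vertex_degree X E k - a) 0\<bar>
      \<le> \<bar>vertex_degree X (insert e E) k - vertex_degree X E k\<bar>" by linarith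
    also have "\<dots> \<le> of_bool (k \<in> e)" by (rule degree_lipschitz[OF finite_X e(1)])
    finally show "\<bar>max (vertex_degree X (insert e E) k - a) 0 - max (vertex_degree X E k - a) 0\<bar> \<le> of_bool (k \<in> e)" .
  qed
  also have "\<dots> = real (card (C \<inter> e))"
    using finC by (simp add: of_bool_def sum.If_cases Int_def)
  also have "\<dots> \<le> real (card e)" using e by (intro of_nat_mono card_mono) auto
  finally show ?thesis using e by simp
qed

text \<open>Markov's inequality for component sizes. As \<open>\<rho>\<close> normalises the total
  weight, the branching bound applies with \<open>s = 1\<close>; the weight bound \<open>h\<close>
  makes it uniform in the starting vertex.\<close>

lemma expect_num_big_le:
  assumes L: "L \<subseteq> X" and A: "0 < A" and \<nu>: "\<rho> * (\<Sum>u\<in>L. (w u)\<^sup>2) \<le> \<nu>" "\<nu> < 1"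
    and h: "0 \<le> h" "\<And>u. u \<in> L \<Longrightarrow> w u \<le> h"
  shows "expect (pairs X) q (num_big L A) \<le> real (card X) * ((1 + h / (1 - \<nu>)) / real A)"
proof -
  have finL: "finite L" using L finite_X finite_subset by blast
  have s: "\<rho> * (\<Sum>u\<in>L. w u) \<le> 1"
    unfolding \<rho>_sum_w[symmetric] using L finite_X w_pos \<rho>_pos
    by (intro mult_left_mono sum_mono2) (auto intro: less_imp_le)
  have "expect (pairs X) q (num_big L A)
    \<le> expect (pairs X) q (\<lambda>E. \<Sum>v\<in>L. real (card (reach E L v)) / real A)"
  proof (intro expect_mono)
    fix E
    have "num_big L A E = (\<Sum>v\<in>L. of_bool (A \<le> card (reach E L v)))"
      using finL by (simp add: num_big_def of_bool_def sum.If_cases Int_def)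
    also have "\<dots> \<le> (\<Sum>v\<in>L. real (card (reach E L v)) / real A)"
      using A by (intro sum_mono) auto
    finally show "num_big L A E \<le> (\<Sum>v\<in>L. real (card (reach E L v)) / real A)" .
  qed (use finite_X in auto)
  also have "\<dots> = (\<Sum>v\<in>L. expect (pairs X) q (\<lambda>E. real (card (reach E L v))) / real A)"
    using finite_X by (subst Bochner_Integration.integral_sum) auto
  also have "\<dots> \<le> (\<Sum>v\<in>L. (1 + h / (1 - \<nu>)) / real A)"
  proof (intro sum_mono divide_right_mono)
    fix v assume v: "v \<in> L"
    have "expect (pairs X) q (\<lambda>E. real (card (reach E L v))) \<le> 1 + w v * (1 / (1 - \<nu>))"
      using finite_X q_bounds finL L w_pos \<rho>_pos s \<nu> v
      by (intro expect_card_reach_le[where L = L and \<rho> = \<rho>])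
        (auto simp: q_pair intro!: pair_in_pairs less_imp_le)
    also have "\<dots> \<le> 1 + h / (1 - \<nu>)" using h(2)[OF v] \<nu> by (simp add: divide_right_mono)
    finally show "expect (pairs X) q (\<lambda>E. real (card (reach E L v))) \<le> 1 + h / (1 - \<nu>)" .
  qed simp
  also have "\<dots> \<le> real (card X) * ((1 + h / (1 - \<nu>)) / real A)"
    using h \<nu> A card_mono[OF finite_X L] by (simp add: mult_right_mono divide_right_mono)
  finally show ?thesis .
qed

text \<open>Union bound over at most \<open>4 ^ n\<close> pairs \<open>(P, Q)\<close>, where
  \<open>n = card B\<close>. Each pair spans at least \<open>n\<^sup>2 / 9\<close> possible edges,
  so \<open>18 \<le> \<eta> * n\<close> makes their expected number at least \<open>2 * n\<close>,
  and \<open>exp (- 2) ^ n\<close> beats \<open>4 ^ n\<close>.\<close>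

lemma prob_separated_le:
  assumes B: "B \<subseteq> X" and \<eta>: "\<And>u v. u \<in> B \<Longrightarrow> v \<in> B \<Longrightarrow> u \<noteq> v \<Longrightarrow> \<eta> \<le> q {u, v}"
    and large: "18 \<le> \<eta> * real (card B)"
  shows "measure_pmf.prob (random_edges (pairs X) q)
    {E. \<exists>P Q. P \<subseteq> B \<and> Q \<subseteq> B \<and> P \<inter> Q = {} \<and> card B \<le> 3 * card P \<and> card B \<le> 3 * card Q
        \<and> (\<forall>p\<in>P. \<forall>r\<in>Q. {p, r} \<notin> E)} \<le> (4 * exp (- 2)) ^ card B"
proof -
  let ?M = "random_edges (pairs X) q"
  define I where "I = {(P, Q). P \<subseteq> B \<and> Q \<subseteq> B \<and> P \<inter> Q = {} \<and> card B \<le> 3 * card P \<and> card B \<le> 3 * card Q}"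
  define F where "F = (\<lambda>(P :: 'a set, Q). (\<lambda>(p, r). {p, r}) ` (P \<times> Q))"
  define n where "n = card B"
  have finB: "finite B" using B finite_X finite_subset by blast
  have I: "I \<subseteq> Pow B \<times> Pow B" by (auto simp: I_def)
  then have finI: "finite I" using finB by (auto intro: finite_subset)
  have "0 < \<eta> * real (card B)" using large by linarith
  then have \<eta>0: "\<eta> > 0" by (simp add: zero_less_mult_iff)
  have F_prob: "measure_pmf.prob ?M {E. E \<inter> F i = {}} \<le> exp (- 2) ^ n" if "i \<in> I" for i
  proof -
    obtain P Q where i: "i = (P, Q)" by (cases i)
    with that have PQ: "i = (P, Q)" "P \<subseteq> B" "Q \<subseteq> B" "P \<inter> Q = {}" "n \<le> 3 * card P" "n \<le> 3 * card Q"
      by (auto simp: I_def n_def)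
    have F: "F i = (\<lambda>(p, r). {p, r}) ` (P \<times> Q)" by (simp add: PQ F_def)
    have sub: "F i \<subseteq> pairs X" using PQ B unfolding F by (auto intro!: pair_in_pairs)
    have inj: "inj_on (\<lambda>(p, r). {p, r}) (P \<times> Q)" using PQ by (auto simp: inj_on_def doubleton_eq_iff)
    have "real n * real n \<le> (3 * real (card P)) * (3 * real (card Q))"
      using PQ(5,6) by (intro mult_mono) linarith+
    then have "(real n * real n / 9) * \<eta> \<le> real (card P * card Q) * \<eta>"
      using \<eta>0 by (intro mult_right_mono) auto
    also have "\<dots> = (\<Sum>e\<in>F i. \<eta>)" unfolding F by (simp add: card_image[OF inj] card_cartesian_product)
    also have "\<dots> \<le> (\<Sum>e\<in>F i. q e)"
      unfolding F using PQ by (intro sum_mono) (auto intro!: \<eta>)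
    finally have "(real n * real n / 9) * \<eta> \<le> (\<Sum>e\<in>F i. q e)" .
    moreover have "real n * 18 \<le> real n * (\<eta> * real n)"
      using large by (intro mult_left_mono) (auto simp: n_def)
    ultimately have "2 * real n \<le> (\<Sum>e\<in>F i. q e)" by (simp add: algebra_simps)
    have "measure_pmf.prob ?M {E. E \<inter> F i = {}} \<le> exp (- (\<Sum>e\<in>F i. q e))"
      using finite_X q_bounds sub by (intro prob_no_edges) auto
    also have "\<dots> \<le> exp (real n * (- 2))" using \<open>2 * real n \<le> (\<Sum>e\<in>F i. q e)\<close> by simp
    also have "\<dots> = exp (- 2) ^ n" by (rule exp_of_nat_mult)
    finally show ?thesis .
  qed
  have "{E. \<exists>P Q. P \<subseteq> B \<and> Q \<subseteq> B \<and> P \<inter> Q = {} \<and> card B \<le> 3 * card P \<and> card B \<le> 3 * card Q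
        \<and> (\<forall>p\<in>P. \<forall>r\<in>Q. {p, r} \<notin> E)} \<subseteq> (\<Union>i\<in>I. {E. E \<inter> F i = {}})"
  proof (intro subsetI, elim CollectE exE conjE)
    fix E P Q assume "P \<subseteq> B" "Q \<subseteq> B" "P \<inter> Q = {}" "card B \<le> 3 * card P" "card B \<le> 3 * card Q"
      and "\<forall>p\<in>P. \<forall>r\<in>Q. {p, r} \<notin> E"
    then have "(P, Q) \<in> I" "E \<inter> F (P, Q) = {}" by (auto simp: I_def F_def)
    then show "E \<in> (\<Union>i\<in>I. {E. E \<inter> F i = {}})" by (intro UN_I) simp_all
  qed
  then have "measure_pmf.prob ?M {E. \<exists>P Q. P \<subseteq> B \<and> Q \<subseteq> B \<and> P \<inter> Q = {} \<and> card B \<le> 3 * card P \<and> card B \<le> 3 * card Q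
        \<and> (\<forall>p\<in>P. \<forall>r\<in>Q. {p, r} \<notin> E)} \<le> measure_pmf.prob ?M (\<Union>i\<in>I. {E. E \<inter> F i = {}})"
    by (intro measure_pmf.finite_measure_mono) auto
  also have "\<dots> \<le> (\<Sum>i\<in>I. measure_pmf.prob ?M {E. E \<inter> F i = {}})"
    by (intro measure_UNION_le finI) auto
  also have "\<dots> \<le> (\<Sum>i\<in>I. exp (- 2) ^ n)" by (intro sum_mono F_prob)
  also have "\<dots> = real (card I) * exp (- 2) ^ n" by simp
  also have "\<dots> \<le> 4 ^ n * exp (- 2) ^ n"
  proof (intro mult_right_mono)
    have "card I \<le> card (Pow B \<times> Pow B)" using finB I by (intro card_mono) auto
    also have "\<dots> = 4 ^ n"
      using finB by (simp add: card_cartesian_product card_Pow n_def flip: power_mult_distrib)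
    finally have "real (card I) \<le> real (4 ^ n)" unfolding of_nat_le_iff .
    then show "real (card I) \<le> 4 ^ n" by simp
  qed simp
  finally show ?thesis by (simp add: n_def power_mult_distrib)
qed

text \<open>The constants form a budget. A largest component with too few core vertices has at most
  \<open>c / 4 * n\<close> vertices of each kind: core vertices, vertices in small pieces charged to
  core degrees, and vertices in large non-core pieces. The total is below \<open>c * n\<close>, the
  size forced by \<open>B\<close>. Each of the two random errors has mean at most half its
  allowance, the other half being left for the deviation.\<close>

lemma prob_core_fraction:
  fixes n :: real and A :: nat
  assumes BC: "B \<subseteq> C" "C \<subseteq> X" and n: "0 < n" "real (card X) \<le> n" and c: "0 < c" "3 * c * n \<le> real (card B)"
    and \<eta>: "\<And>u v. u \<in> B \<Longrightarrow> v \<in> B \<Longrightarrow> u \<noteq> v \<Longrightarrow> \<eta> \<le> q {u, v}" "18 \<le> \<eta> * real (card B)"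
    and \<nu>: "\<rho> * (\<Sum>u\<in>X - C. (w u)\<^sup>2) \<le> \<nu>" "\<nu> < 1"
    and h: "0 \<le> h" "\<And>u. u \<in> X - C \<Longrightarrow> w u \<le> h"
    and D: "(\<Sum>u\<in>X. w u) \<le> D * n"
    and A: "0 < A" "(1 + h / (1 - \<nu>)) / real A \<le> c / 8" "real A \<le> c * n"
    and t: "0 \<le> t" "t < a" "(\<Sum>k\<in>{k \<in> X. t < w k}. w k) \<le> c / (32 * A) * n" "t / (4 * (a - t)) \<le> c / (32 * A)"
    and \<delta>: "0 < \<delta>" "\<delta> * a \<le> c / (8 * A)" "\<delta> \<le> c / 4"
  shows "measure_pmf.prob (random_edges (pairs X) q)
      {E. \<not> (\<forall>V. giant_component X E V \<longrightarrow> c * n \<le> real (card V) \<and> \<delta> * real (card V) \<le> real (card (V \<inter> C)))}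
    \<le> (4 * exp (- 2)) ^ card B + ((2 * real A)\<^sup>2 * D / (c / 8)\<^sup>2 + 2\<^sup>2 * D / (c / (16 * A))\<^sup>2) / n"
    (is "measure_pmf.prob ?M ?bad \<le> _")
proof -
  define L where "L = X - C"
  \<comment> \<open>The sum runs over all of \<open>C\<close> and not over
    \<open>V \<inter> C\<close>, because \<open>V\<close> depends on \<open>E\<close>.\<close>
  define Z where "Z = (\<lambda>E. \<Sum>k\<in>C. max (vertex_degree X E k - a) 0)"
  define bad1 where "bad1 = {E. \<exists>P Q. P \<subseteq> B \<and> Q \<subseteq> B \<and> P \<inter> Q = {} \<and> card B \<le> 3 * card P \<and> card B \<le> 3 * card Q
        \<and> (\<forall>p\<in>P. \<forall>r\<in>Q. {p, r} \<notin> E)}"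
  define bad2 where "bad2 = {E. num_big L A E > c / 8 * n + c / 8 * n}"
  define bad3 where "bad3 = {E. Z E > c / (16 * A) * n + c / (16 * A) * n}"
  have BX: "B \<subseteq> X" using BC by auto
  have finB: "finite B" and finC: "finite C" using BC finite_X BX by (auto intro: finite_subset)
  have "0 < 3 * c * n" using c n by simp
  then have "0 < card B" using c by linarith
  then have Bne: "B \<noteq> {}" by auto
  have q01: "\<And>e. e \<in> pairs X \<Longrightarrow> 0 \<le> q e \<and> q e \<le> 1" by (rule q_bounds)
  have sumq: "(\<Sum>e\<in>pairs X. q e) \<le> D * n" using sum_q_le D by linarith
  have p1: "measure_pmf.prob ?M bad1 \<le> (4 * exp (- 2)) ^ card B"
    unfolding bad1_def by (rule prob_separated_le[OF BX \<eta>])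
  have p2: "measure_pmf.prob ?M bad2 \<le> (2 * real A)\<^sup>2 * (\<Sum>e\<in>pairs X. q e) / (c / 8 * n)\<^sup>2"
    unfolding bad2_def
  proof (intro prob_lipschitz_deviation q01)
    show "\<bar>num_big L A (insert e E) - num_big L A E\<bar> \<le> 2 * real A" if "e \<in> pairs X" for e E
      using that finite_X by (intro num_big_lipschitz) (auto simp: pairs_def L_def)
    have "expect (pairs X) q (num_big L A) \<le> real (card X) * ((1 + h / (1 - \<nu>)) / real A)"
      using \<nu> h A by (intro expect_num_big_le) (auto simp: L_def)
    also have "\<dots> \<le> n * (c / 8)" using n A h \<nu> by (intro mult_mono) auto
    finally show "expect (pairs X) q (num_big L A) \<le> c / 8 * n" by (simp add: mult.commute)
  qed (use finite_X c n in auto)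
  have p3: "measure_pmf.prob ?M bad3 \<le> 2\<^sup>2 * (\<Sum>e\<in>pairs X. q e) / (c / (16 * A) * n)\<^sup>2"
    unfolding bad3_def
  proof (intro prob_lipschitz_deviation q01)
    show "\<bar>Z (insert e E) - Z E\<bar> \<le> 2" if "e \<in> pairs X" for e E
      unfolding Z_def by (rule sum_excess_degree_lipschitz[OF BC(2) that])
    have "expect (pairs X) q Z \<le> real (card X) * (t / (4 * (a - t))) + (\<Sum>k\<in>{k \<in> X. t < w k}. w k)"
      unfolding Z_def by (rule expect_sum_excess_degree_le[OF BC(2) t(1,2)])
    also have "\<dots> \<le> n * (c / (32 * A)) + c / (32 * A) * n"
      using n t by (intro add_mono mult_mono) auto
    finally show "expect (pairs X) q Z \<le> c / (16 * A) * n" by (simp add: field_simps)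
  qed (use finite_X c n A in auto)
  \<comment> \<open>On the support \<open>E \<subseteq> pairs X\<close>, which keeps the components
    inside \<open>X\<close>.\<close>
  have "?bad \<inter> set_pmf ?M \<subseteq> bad1 \<union> (bad2 \<union> bad3)"
  proof
    fix E assume E: "E \<in> ?bad \<inter> set_pmf ?M"
    then have EX: "E \<subseteq> pairs X" using set_random_edges[of "pairs X" q] finite_X by auto
    obtain V where V: "giant_component X E V"
      and Vbad: "\<not> (c * n \<le> real (card V) \<and> \<delta> * real (card V) \<le> real (card (V \<inter> C)))" using E by auto
    show "E \<in> bad1 \<union> (bad2 \<union> bad3)"
    proof (rule ccontr)
      assume "E \<notin> bad1 \<union> (bad2 \<union> bad3)"
      then have good1: "E \<notin> bad1" and "E \<notin> bad2" "E \<notin> bad3" by auto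
      from \<open>E \<notin> bad2\<close> have good2: "num_big L A E \<le> c / 8 * n + c / 8 * n"
        unfolding bad2_def mem_Collect_eq not_less .
      from \<open>E \<notin> bad3\<close> have good3: "Z E \<le> c / (16 * A) * n + c / (16 * A) * n"
        unfolding bad3_def mem_Collect_eq not_less .
      have sub: "V' \<subseteq> X" if "V' \<in> components X E" for V'
        using EX by (intro components_subset[OF _ that]) (auto simp: pairs_def)
      have Vc: "V \<in> components X E" using V by (simp add: giant_component_def)
      have finV: "finite V" using sub[OF Vc] finite_X finite_subset by blast
      have "\<exists>V\<in>components X E. card B \<le> 3 * card (V \<inter> B)"
      proof (rule exists_large_component[OF finite_X BX Bne])
        fix P Q assume *: "P \<subseteq> B" "Q \<subseteq> B" "P \<inter> Q = {}" "card B \<le> 3 * card P" "card B \<le> 3 * card Q"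
        show "\<exists>p\<in>P. \<exists>r\<in>Q. {p, r} \<in> E"
        proof (rule ccontr)
          assume "\<not> ?thesis"
          then have "\<forall>p\<in>P. \<forall>r\<in>Q. {p, r} \<notin> E" by simp
          with * have "E \<in> bad1" unfolding bad1_def mem_Collect_eq by (intro exI[of _ P] exI[of _ Q] conjI)
          with good1 show False by simp
        qed
      qed
      then obtain V' where V': "V' \<in> components X E" "card B \<le> 3 * card (V' \<inter> B)" by auto
      have "card (V' \<inter> B) \<le> card V'"
        using sub[OF V'(1)] finite_X by (intro card_mono) (auto intro: finite_subset)
      also have "\<dots> \<le> card V" using V V'(1) by (simp add: giant_component_def)
      finally have "real (card B) \<le> 3 * real (card V)" using V'(2) by linarith
      then have cV: "c * n \<le> real (card V)" using c by linarith
      with Vbad have few: "real (card (V \<inter> C)) < \<delta> * real (card V)" by auto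
      have Vn: "real (card V) \<le> n" using card_mono[OF finite_X sub[OF Vc]] n by linarith
      then have "\<delta> * real (card V) \<le> \<delta> * n" using \<delta> by (intro mult_left_mono) auto
      with few have few': "real (card (V \<inter> C)) < \<delta> * n" by linarith
      \<comment> \<open>The truncated part costs \<open>a\<close> for each of the few vertices of
        \<open>V \<inter> C\<close>; what exceeds \<open>a\<close> is absorbed by
        \<open>Z E\<close>.\<close>
      have "(\<Sum>k\<in>V \<inter> C. vertex_degree X E k) \<le> (\<Sum>k\<in>V \<inter> C. a + max (vertex_degree X E k - a) 0)"
        by (intro sum_mono) auto
      also have "\<dots> = real (card (V \<inter> C)) * a + (\<Sum>k\<in>V \<inter> C. max (vertex_degree X E k - a) 0)"
        by (simp add: sum.distrib)
      also have "\<dots> \<le> \<delta> * n * a + Z E"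
        unfolding Z_def using few' t finC by (intro add_mono mult_right_mono sum_mono2) auto
      also have "\<delta> * n * a = \<delta> * a * n" by simp
      also have "\<delta> * a * n \<le> c / (8 * A) * n" using \<delta> n by (intro mult_right_mono) auto
      finally have "(\<Sum>k\<in>V \<inter> C. vertex_degree X E k) \<le> c / (4 * A) * n" using good3 A(1) by (simp add: field_simps)
      then have deg: "real A * (\<Sum>k\<in>V \<inter> C. vertex_degree X E k) \<le> real A * (c / (4 * A) * n)"
        by (intro mult_left_mono) auto
      have "real A \<le> real (card V)" using A(3) cV by linarith
      then have "A \<le> card V" by simp
      have "real (card V) \<le> real (card (V \<inter> C)) + real A * (\<Sum>k\<in>V \<inter> C. vertex_degree X E k) + num_big L A E"
        unfolding L_def by (rule card_component_le[OF finite_X EX Vc BC(2) \<open>A \<le> card V\<close>])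
      also have "\<dots> < \<delta> * n + real A * (c / (4 * A) * n) + (c / 8 * n + c / 8 * n)"
        using few' deg good2 by linarith
      also have "\<delta> * n \<le> c / 4 * n" using \<delta> n by (intro mult_right_mono) auto
      also have "real A * (c / (4 * A) * n) = c / 4 * n" using A(1) by simp
      also have "c / 4 * n + c / 4 * n + (c / 8 * n + c / 8 * n) \<le> c * n" using c n by simp
      finally show False using cV by simp
    qed
  qed
  then have "measure_pmf.prob ?M ?bad \<le> measure_pmf.prob ?M (bad1 \<union> (bad2 \<union> bad3))"
    unfolding measure_Int_set_pmf[of ?M ?bad, symmetric] by (intro measure_pmf.finite_measure_mono) auto
  also have "\<dots> \<le> measure_pmf.prob ?M bad1 + (measure_pmf.prob ?M bad2 + measure_pmf.prob ?M bad3)"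
    by (intro order.trans[OF measure_Un_le] add_left_mono measure_Un_le) auto
  also have "\<dots> \<le> (4 * exp (- 2)) ^ card B
    + ((2 * real A)\<^sup>2 * (D * n) / (c / 8 * n)\<^sup>2 + 2\<^sup>2 * (D * n) / (c / (16 * A) * n)\<^sup>2)"
    using sumq
    by (intro add_mono p1 order.trans[OF p2] order.trans[OF p3] divide_right_mono mult_left_mono) auto
  also have "\<dots> = (4 * exp (- 2)) ^ card B
    + ((2 * real A)\<^sup>2 * D / (c / 8)\<^sup>2 + 2\<^sup>2 * D / (c / (16 * A))\<^sup>2) / n"
    using n by (simp add: power2_eq_square field_simps)
  finally show ?thesis .
qed

end

subsection \<open>Power-law weights\<close>

text \<open>Mean value theorem for the antiderivative of \<open>y powr (- p)\<close>. Sums of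
  weights need \<open>p = a < 1\<close>, sums of squared weights
  \<open>p = 2 * a > 1\<close>.\<close>

lemma powr_integral_step:
  fixes x p :: real
  assumes "0 < x" "0 < p" "p \<noteq> 1"
  shows "(x + 1) powr (- p) \<le> ((x + 1) powr (1 - p) - x powr (1 - p)) / (1 - p)"
    and "((x + 1) powr (1 - p) - x powr (1 - p)) / (1 - p) \<le> x powr (- p)"
proof -
  have "((\<lambda>y. y powr (1 - p) / (1 - p)) has_real_derivative y powr (- p)) (at y)" if "x \<le> y" for y
    using that assms by (auto intro!: derivative_eq_intros)
  then obtain z where z: "x < z" "z < x + 1"
    "(x + 1) powr (1 - p) / (1 - p) - x powr (1 - p) / (1 - p) = (x + 1 - x) * z powr (- p)"
    using MVT2[of x "x + 1" "\<lambda>y. y powr (1 - p) / (1 - p)" "\<lambda>y. y powr (- p)"] by auto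
  then have eq: "((x + 1) powr (1 - p) - x powr (1 - p)) / (1 - p) = z powr (- p)"
    by (simp add: diff_divide_distrib)
  show "(x + 1) powr (- p) \<le> ((x + 1) powr (1 - p) - x powr (1 - p)) / (1 - p)"
    unfolding eq using z assms by (intro powr_mono2') auto
  show "((x + 1) powr (1 - p) - x powr (1 - p)) / (1 - p) \<le> x powr (- p)"
    unfolding eq using z assms by (intro powr_mono2') auto
qed

lemma sum_powr_ge:
  fixes p :: real
  assumes "0 < s" "0 < p" "p \<noteq> 1"
  shows "(real (s + n) powr (1 - p) - real s powr (1 - p)) / (1 - p) \<le> (\<Sum>i\<in>{s..<s + n}. real i powr (- p))"
proof (induction n)
  case (Suc n)
  have "(real (s + Suc n) powr (1 - p) - real s powr (1 - p)) / (1 - p)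
    = (real (s + n) powr (1 - p) - real s powr (1 - p)) / (1 - p)
      + ((real (s + n) + 1) powr (1 - p) - real (s + n) powr (1 - p)) / (1 - p)"
    by (simp add: diff_divide_distrib add_ac)
  also have "\<dots> \<le> (\<Sum>i\<in>{s..<s + n}. real i powr (- p)) + real (s + n) powr (- p)"
    using assms by (intro add_mono Suc.IH powr_integral_step) auto
  finally show ?case by simp
qed simp

text \<open>Each term is compared with the integral over the unit interval to its left, hence the
  shift by 1 and the condition \<open>1 < s\<close>.\<close>

lemma sum_powr_le:
  fixes p :: real
  assumes "1 < s" "0 < p" "p \<noteq> 1"
  shows "(\<Sum>i\<in>{s..<s + n}. real i powr (- p)) \<le> ((real (s + n) - 1) powr (1 - p) - (real s - 1) powr (1 - p)) / (1 - p)"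
proof (induction n)
  case (Suc n)
  have "(\<Sum>i\<in>{s..<s + Suc n}. real i powr (- p)) = (\<Sum>i\<in>{s..<s + n}. real i powr (- p)) + (real (s + n) - 1 + 1) powr (- p)"
    by simp
  also have "\<dots> \<le> ((real (s + n) - 1) powr (1 - p) - (real s - 1) powr (1 - p)) / (1 - p)
      + ((real (s + n) - 1 + 1) powr (1 - p) - (real (s + n) - 1) powr (1 - p)) / (1 - p)"
    using assms by (intro add_mono Suc.IH powr_integral_step) auto
  also have "\<dots> = ((real (s + Suc n) - 1) powr (1 - p) - (real s - 1) powr (1 - p)) / (1 - p)"
    by (simp add: diff_divide_distrib add_ac)
  finally show ?case .
qed simp

lemma sum_powr_le_from_1:
  fixes p :: real
  assumes "0 < p" "p < 1"
  shows "(\<Sum>i\<in>{1..n}. real i powr (- p)) \<le> real n powr (1 - p) / (1 - p)"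
proof (cases "n = 0")
  case False
  then obtain m where m: "n = Suc m" by (cases n) auto
  have "(\<Sum>i\<in>{1..n}. real i powr (- p)) = 1 + (\<Sum>i\<in>{2..<2 + m}. real i powr (- p))"
    unfolding m
    by (subst sum.atLeast_Suc_atMost) (auto simp: atLeastLessThanSuc_atLeastAtMost numeral_2_eq_2 simp del: sum.op_ivl_Suc)
  \<comment> \<open>The first term, 1, is at most \<open>1 / (1 - p)\<close> and cancels the
    contribution of the lower limit.\<close>
  also have "\<dots> \<le> 1 / (1 - p) + (real n powr (1 - p) - 1) / (1 - p)"
    using sum_powr_le[of 2 p m] assms m by (intro add_mono) (auto simp: add_ac)
  finally show ?thesis by (simp add: diff_divide_distrib)
qed simp

text \<open>
  A power-law weight sequence in normalised form: \<open>a = 1/(\<beta>-1)\<close>, \<open>\<kappa> = (1-a) wbar\<close> is the limit of the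
  minimum weight, and \<open>s = \<lceil>i\<^sub>0\<rceil>\<close>.
\<close>

locale power_law =
  fixes a wbar \<kappa> :: real and s :: "nat \<Rightarrow> nat"
  assumes a: "1 / 2 < a" "a < 1" and wbar: "0 < wbar" and \<kappa>: "\<kappa> = (1 - a) * wbar"
    and s_pos: "eventually (\<lambda>N. 0 < s N) sequentially"
    and s_small: "(\<lambda>N. real (s N) / real N) \<longlonglongrightarrow> 0"
begin

definition wt :: "nat \<Rightarrow> nat \<Rightarrow> real" where
  "wt N i = \<kappa> * real N powr a * real i powr (- a)"

abbreviation verts :: "nat \<Rightarrow> nat set" where
  "verts N \<equiv> {s N..<s N + N}"

lemma \<kappa>_pos: "0 < \<kappa>" using a wbar \<kappa> by simp

lemma s_le: "0 < e \<Longrightarrow> eventually (\<lambda>N. real (s N) \<le> e * real N) sequentially"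
proof -
  assume "0 < e"
  with s_small have "eventually (\<lambda>N. real (s N) / real N < e) sequentially" by (rule order_tendstoD)
  then show ?thesis using eventually_gt_at_top[of 0]
    by eventually_elim (auto simp: field_simps)
qed

lemma wt_pos: "0 < N \<Longrightarrow> 0 < i \<Longrightarrow> 0 < wt N i"
  using \<kappa>_pos by (simp add: wt_def)

lemma wt_antimono: "0 < i \<Longrightarrow> i \<le> j \<Longrightarrow> wt N j \<le> wt N i"
  unfolding wt_def using a \<kappa>_pos by (intro mult_left_mono powr_mono2') auto

text \<open>The weight at index \<open>\<tau> * N\<close> does not depend on \<open>N\<close>. This
  converts constant weight thresholds into constant fractions of the indices.\<close>

lemma wt_scale:
  assumes "0 < N" "0 < \<tau>"
  shows "\<kappa> * real N powr a * (\<tau> * real N) powr (- a) = \<kappa> * \<tau> powr (- a)"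
  using assms by (simp add: powr_mult powr_minus field_simps)

lemma wt_ge: "0 < N \<Longrightarrow> 0 < \<tau> \<Longrightarrow> 0 < i \<Longrightarrow> real i \<le> \<tau> * real N \<Longrightarrow> \<kappa> * \<tau> powr (- a) \<le> wt N i"
  unfolding wt_def using a \<kappa>_pos
  by (subst wt_scale[symmetric, of N]) (auto intro!: mult_left_mono powr_mono2')

lemma wt_le: "0 < N \<Longrightarrow> 0 < \<tau> \<Longrightarrow> \<tau> * real N \<le> real i \<Longrightarrow> wt N i \<le> \<kappa> * \<tau> powr (- a)"
  unfolding wt_def using a \<kappa>_pos
  by (subst wt_scale[symmetric, of N]) (auto intro!: mult_left_mono powr_mono2')

text \<open>Uniform integrability: the \<open>\<tau>\<close>-fraction of smallest indices carries a
  share of the weight that vanishes with \<open>\<tau>\<close>, since \<open>a < 1\<close>. The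
  constant is \<open>\<kappa> / (1 - a) = wbar\<close>.\<close>

lemma sum_wt_le:
  assumes "0 < N" "0 < \<tau>"
  shows "(\<Sum>i\<in>{i. 0 < i \<and> real i \<le> \<tau> * real N}. wt N i) \<le> wbar * \<tau> powr (1 - a) * real N"
proof -
  define n where "n = nat \<lfloor>\<tau> * real N\<rfloor>"
  have n: "real n \<le> \<tau> * real N" using assms by (simp add: n_def)
  have "{i. 0 < i \<and> real i \<le> \<tau> * real N} = {1..n}"
    using assms by (auto simp: n_def le_nat_floor) (metis n n_def of_nat_le_iff order_trans)
  then have "(\<Sum>i\<in>{i. 0 < i \<and> real i \<le> \<tau> * real N}. wt N i)
    = \<kappa> * real N powr a * (\<Sum>i\<in>{1..n}. real i powr (- a))"
    by (simp add: wt_def sum_distrib_left)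
  also have "\<dots> \<le> \<kappa> * real N powr a * (real n powr (1 - a) / (1 - a))"
    using \<kappa>_pos a by (intro mult_left_mono sum_powr_le_from_1) auto
  also have "\<dots> \<le> \<kappa> * real N powr a * ((\<tau> * real N) powr (1 - a) / (1 - a))"
    using \<kappa>_pos a n by (intro mult_left_mono divide_right_mono powr_mono2) auto
  also have "\<dots> = wbar * \<tau> powr (1 - a) * (real N powr a * real N powr (1 - a))"
    using a assms by (simp add: \<kappa> powr_mult)
  also have "\<dots> = wbar * \<tau> powr (1 - a) * real N"
    using assms by (simp flip: powr_add)
  finally show ?thesis .
qed

lemma sum_verts_le: "eventually (\<lambda>N. (\<Sum>i\<in>verts N. wt N i) \<le> 2 * wbar * real N) sequentially"
  using s_pos s_le[of 1, simplified] eventually_gt_at_top[of 0]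
proof eventually_elim
  case (elim N)
  have "finite {i. 0 < i \<and> real i \<le> 2 * real N}"
    by (rule finite_subset[of _ "{..2 * N}"]) auto
  then have "(\<Sum>i\<in>verts N. wt N i) \<le> (\<Sum>i\<in>{i. 0 < i \<and> real i \<le> 2 * real N}. wt N i)"
    using elim by (intro sum_mono2) (auto intro!: less_imp_le[OF wt_pos])
  also have "\<dots> \<le> wbar * 2 powr (1 - a) * real N" by (rule sum_wt_le) (use elim in auto)
  also have "\<dots> \<le> wbar * 2 powr 1 * real N"
    using wbar a by (intro mult_right_mono mult_left_mono powr_mono) auto
  finally show ?case by simp
qed

text \<open>Unlike the upper bound with its factor 2, this must be asymptotically sharp: the total
  weight is the denominator of the branching factor, which has to stay below 1.\<close>

lemma sum_verts_ge:
  assumes "0 < e"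
  shows "eventually (\<lambda>N. (wbar - e) * real N \<le> (\<Sum>i\<in>verts N. wt N i)) sequentially"
proof -
  have "(\<lambda>N. wbar * (1 - (real (s N) / real N) powr (1 - a))) \<longlonglongrightarrow> wbar * (1 - 0)"
    using a by (intro tendsto_intros tendsto_zero_powrI[OF s_small tendsto_const]) auto
  then have "eventually (\<lambda>N. wbar - e < wbar * (1 - (real (s N) / real N) powr (1 - a))) sequentially"
    using assms by (intro order_tendstoD) auto
  then show ?thesis using s_pos eventually_gt_at_top[of 0]
  proof eventually_elim
    case (elim N)
    have "(wbar - e) * real N \<le> wbar * (1 - (real (s N) / real N) powr (1 - a)) * real N"
      using elim by (intro mult_right_mono) auto
    also have "\<dots> = wbar * (1 - (real (s N) / real N) powr (1 - a)) * (real N powr a * real N powr (1 - a))"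
      using elim by (simp flip: powr_add)
    also have "\<dots> = wbar * real N powr a * (real N powr (1 - a) - real (s N) powr (1 - a))"
      using elim by (simp add: powr_divide field_simps)
    also have "\<dots> \<le> wbar * real N powr a * (real (s N + N) powr (1 - a) - real (s N) powr (1 - a))"
      using wbar a by (intro mult_left_mono diff_mono powr_mono2) auto
    also have "\<dots> = \<kappa> * real N powr a * ((real (s N + N) powr (1 - a) - real (s N) powr (1 - a)) / (1 - a))"
      using a by (simp add: \<kappa>)
    also have "\<dots> \<le> \<kappa> * real N powr a * (\<Sum>i\<in>verts N. real i powr (- a))"
      using \<kappa>_pos a elim by (intro mult_left_mono sum_powr_ge) auto
    finally show ?case by (simp add: wt_def sum_distrib_left)
  qed
qed

lemma card_low_index_ge:
  assumes "0 < \<tau>" "\<tau> < 1"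
  shows "eventually (\<lambda>N. \<tau> / 2 * real N \<le> real (card {i \<in> verts N. real i \<le> \<tau> * real N})) sequentially"
  using s_le[of "\<tau> / 2", OF half_gt_zero[OF assms(1)]] eventually_gt_at_top[of 0]
proof eventually_elim
  case (elim N)
  define n where "n = nat \<lfloor>\<tau> * real N\<rfloor>"
  have n: "real n \<le> \<tau> * real N" "\<tau> * real N < real n + 1"
    using assms by (auto simp: n_def intro: less_imp_le)
  have "\<tau> * real N < real N" using assms elim by simp
  then have "{s N..n} \<subseteq> {i \<in> verts N. real i \<le> \<tau> * real N}"
    using n by (auto intro: order_trans[of _ "real n"]) 
  then have "card {s N..n} \<le> card {i \<in> verts N. real i \<le> \<tau> * real N}" by (intro card_mono) auto
  moreover have "real n + 1 - real (s N) \<le> real (card {s N..n})" by simp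
  ultimately have "real n + 1 - real (s N) \<le> real (card {i \<in> verts N. real i \<le> \<tau> * real N})" by linarith
  then show ?case using n elim by (simp add: field_simps)
qed

text \<open>A Riemann sum: the weight is at most \<open>l\<close> times the minimum from relative
  index \<open>l powr (- 1 / a)\<close> on, and the sum is compared with
  \<open>\<kappa>\<^sup>2 * N\<close> times the integral of \<open>x powr (- (2 * a))\<close> from
  there to 1. Division by the total weight, about \<open>wbar * N\<close>, leaves
  \<open>\<nu>\<close>. For \<open>l < 1\<close> the sum is empty although the formula for
  \<open>\<nu>\<close> is negative, hence the case distinction.\<close>

lemma low_weight_sum_le:
  assumes l: "0 < l" and e: "0 < e"
  defines "\<nu> \<equiv> wbar * (1 - a)\<^sup>2 / (2 * a - 1) * (l powr ((2 * a - 1) / a) - 1)"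
  shows "eventually (\<lambda>N. (\<Sum>i\<in>{i \<in> verts N. wt N i \<le> l * wt N (s N + N - 1)}. (wt N i)\<^sup>2)
    \<le> (if l < 1 then 0 else wbar * \<nu> + e) * real N) sequentially"
proof (cases "l < 1")
  case True
  show ?thesis using s_pos eventually_gt_at_top[of 0]
  proof eventually_elim
    case (elim N)
    have "\<not> wt N i \<le> l * wt N (s N + N - 1)" if "i \<in> verts N" for i
    proof -
      have "l * wt N (s N + N - 1) < 1 * wt N (s N + N - 1)"
        using True elim by (intro mult_strict_right_mono wt_pos) auto
      also have "1 * wt N (s N + N - 1) \<le> wt N i" unfolding mult_1 using that elim by (intro wt_antimono) auto
      finally show ?thesis by simp
    qed
    then have empty: "{i \<in> verts N. wt N i \<le> l * wt N (s N + N - 1)} = {}" by blast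
    show ?case unfolding empty using True by simp
  qed
next
  case False
  define b where "b = l powr (- 1 / a)"
  have b: "0 < b" "b \<le> 1" using l False a by (auto simp: b_def powr_minus divide_le_eq powr_mono2' ge_one_powr_ge_zero field_simps intro!: powr_le_one_le)
  define m where "m = (\<lambda>N. (real (s N) + real N - 1) / real N)"
  have m: "m \<longlonglongrightarrow> 1"
  proof -
    have "(\<lambda>N. real (s N) / real N + (real N - 1) / real N) \<longlonglongrightarrow> 0 + 1"
      by (intro tendsto_add s_small) real_asymp
    then show ?thesis by (simp add: m_def add_divide_distrib diff_divide_distrib add_diff_eq)
  qed
  have inv: "(\<lambda>N. 1 / real N) \<longlonglongrightarrow> 0" by real_asymp
  \<comment> \<open>The integral bound divided by \<open>N\<close>: \<open>m N\<close> is the last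
    index over \<open>N\<close>, and \<open>1 / real N\<close> is the unit shift at the lower
    limit.\<close>
  define U where "U = (\<lambda>N. \<kappa>\<^sup>2 * ((m N powr (1 - 2 * a) - (m N * b - 1 / real N) powr (1 - 2 * a)) / (1 - 2 * a)))"
  have "U \<longlonglongrightarrow> \<kappa>\<^sup>2 * ((1 powr (1 - 2 * a) - (1 * b - 0) powr (1 - 2 * a)) / (1 - 2 * a))"
    unfolding U_def using a b by (intro tendsto_intros m inv) auto
  also have "\<kappa>\<^sup>2 * ((1 powr (1 - 2 * a) - (1 * b - 0) powr (1 - 2 * a)) / (1 - 2 * a)) = wbar * \<nu>"
  proof -
    have "(- 1 / a) * (1 - 2 * a) = (2 * a - 1) / a" using a by (simp add: field_simps)
    then have "b powr (1 - 2 * a) = l powr ((2 * a - 1) / a)" by (simp only: b_def powr_powr)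
    then have "\<kappa>\<^sup>2 * ((1 powr (1 - 2 * a) - (1 * b - 0) powr (1 - 2 * a)) / (1 - 2 * a))
      = \<kappa>\<^sup>2 * ((l powr ((2 * a - 1) / a) - 1) / (2 * a - 1))"
      using minus_divide_divide[of "l powr ((2 * a - 1) / a) - 1" "2 * a - 1"] by simp
    then show ?thesis by (simp add: \<nu>_def \<kappa> power2_eq_square algebra_simps)
  qed
  finally have "eventually (\<lambda>N. U N < wbar * \<nu> + e) sequentially"
    using e by (intro order_tendstoD) auto
  \<comment> \<open>This gives \<open>2 < real M * b\<close>, so the first index \<open>k\<close>
    exceeds 1 and the shifted integral starts at a positive point.\<close>
  moreover have "(\<lambda>N. m N * b - 2 / real N) \<longlonglongrightarrow> 1 * b - 0"
    by (intro tendsto_intros m)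
  then have "eventually (\<lambda>N. 0 < m N * b - 2 / real N) sequentially"
    using b by (intro order_tendstoD) auto
  ultimately show ?thesis using s_pos eventually_gt_at_top[of 0]
  proof eventually_elim
    case (elim N)
    define M where "M = s N + N - 1"
    define k where "k = nat \<lceil>real M * b\<rceil>"
    have M: "0 < M" "real M = m N * real N" "s N + N = Suc M" using elim by (auto simp: M_def m_def)
    have "2 < m N * b * real N" using elim by (simp add: field_simps)
    then have Mb: "2 < real M * b" by (simp add: M mult_ac)
    have k: "real M * b \<le> real k" using Mb by (simp add: k_def)
    have "real M * b \<le> real M" using b M by (simp add: mult_left_le)
    then have kM: "k \<le> M" by (simp add: k_def ceiling_le_iff nat_le_iff)
    have k2: "1 < k" using k Mb by linarith
    have sub: "{i \<in> verts N. wt N i \<le> l * wt N M} \<subseteq> {k..<k + (Suc M - k)}"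
    proof
      fix i assume "i \<in> {i \<in> verts N. wt N i \<le> l * wt N M}"
      then have i: "0 < i" "i < Suc M" "wt N i \<le> l * wt N M" using elim M by auto
      have "real i powr (- a) \<le> l * real M powr (- a)"
        using i(3) \<kappa>_pos elim by (simp add: wt_def mult.left_commute mult_le_cancel_left_pos)
      then have "(l * real M powr (- a)) powr (- 1 / a) \<le> (real i powr (- a)) powr (- 1 / a)"
        using a i(1) by (intro powr_mono2') auto
      also have "(real i powr (- a)) powr (- 1 / a) = real i" using a i(1) by (simp add: powr_powr)
      also have "(l * real M powr (- a)) powr (- 1 / a) = b * real M"
        using a l by (simp add: powr_mult powr_powr b_def)
      finally have "real M * b \<le> real i" by (simp add: mult.commute)
      then have "k \<le> i" by (simp add: k_def ceiling_le_iff nat_le_iff)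
      then show "i \<in> {k..<k + (Suc M - k)}" using i by auto
    qed
    have sq: "(x powr y)\<^sup>2 = x powr (2 * y)" for x y :: real
      by (simp add: power2_eq_square flip: powr_add)
    have "(\<Sum>i\<in>{i \<in> verts N. wt N i \<le> l * wt N M}. (wt N i)\<^sup>2)
      \<le> (\<Sum>i\<in>{k..<k + (Suc M - k)}. (wt N i)\<^sup>2)"
      using sub by (intro sum_mono2) auto
    also have "\<dots> = \<kappa>\<^sup>2 * real N powr (2 * a) * (\<Sum>i\<in>{k..<k + (Suc M - k)}. real i powr (- (2 * a)))"
      unfolding sum_distrib_left wt_def
      by (intro sum.cong refl) (simp add: power_mult_distrib sq)
    also have "\<dots> \<le> \<kappa>\<^sup>2 * real N powr (2 * a) *
        (((real (k + (Suc M - k)) - 1) powr (1 - 2 * a) - (real k - 1) powr (1 - 2 * a)) / (1 - 2 * a))"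
      using a k2 by (intro mult_left_mono sum_powr_le) auto
    also have "\<dots> = \<kappa>\<^sup>2 * real N powr (2 * a) *
        (((real k - 1) powr (1 - 2 * a) - real M powr (1 - 2 * a)) / (2 * a - 1))"
      using kM minus_divide_divide[of "(real k - 1) powr (1 - 2 * a) - real M powr (1 - 2 * a)" "2 * a - 1"] by simp
    also have "\<dots> \<le> \<kappa>\<^sup>2 * real N powr (2 * a) *
        (((real M * b - 1) powr (1 - 2 * a) - real M powr (1 - 2 * a)) / (2 * a - 1))"
      using a k Mb M(1) by (intro mult_left_mono divide_right_mono diff_mono powr_mono2') auto
    also have "\<dots> = \<kappa>\<^sup>2 * real N powr (2 * a) *
        ((((m N * b - 1 / real N) * real N) powr (1 - 2 * a) - (m N * real N) powr (1 - 2 * a)) / (2 * a - 1))"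
      using elim by (simp add: M algebra_simps)
    also have "\<dots> = \<kappa>\<^sup>2 * (real N powr (2 * a) * real N powr (1 - 2 * a)) *
        (((m N * b - 1 / real N) powr (1 - 2 * a) - m N powr (1 - 2 * a)) / (2 * a - 1))"
    proof -
      have "0 \<le> m N" "0 \<le> m N * b - 1 / real N"
        using elim M(2) Mb by (auto simp: m_def field_simps)
      then have "((m N * b - 1 / real N) * real N) powr (1 - 2 * a)
          = (m N * b - 1 / real N) powr (1 - 2 * a) * real N powr (1 - 2 * a)"
        and "(m N * real N) powr (1 - 2 * a) = m N powr (1 - 2 * a) * real N powr (1 - 2 * a)"
        by (simp_all add: powr_mult)
      then show ?thesis by (simp add: left_diff_distrib[symmetric])
    qed
    also have "real N powr (2 * a) * real N powr (1 - 2 * a) = real N"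
      using elim by (simp flip: powr_add)
    also have "\<kappa>\<^sup>2 * real N * (((m N * b - 1 / real N) powr (1 - 2 * a) - m N powr (1 - 2 * a)) / (2 * a - 1))
      = U N * real N"
    proof -
      have "(x - y) / (2 * a - 1) = (y - x) / (1 - 2 * a)" for x y :: real
        by (metis minus_diff_eq minus_divide_divide)
      then show ?thesis by (simp only: U_def mult_ac)
    qed
    also have "\<dots> \<le> (wbar * \<nu> + e) * real N" using elim by (intro mult_right_mono) auto
    finally show ?case using False by (simp add: M_def)
  qed
qed

end

subsection \<open>The core of the largest component\<close>

context power_law begin

lemma core_fraction_whp:
  fixes l :: real
  defines "W \<equiv> \<lambda>N. \<Sum>i\<in>verts N. wt N i"
  defines "core \<equiv> \<lambda>N. {u \<in> verts N. l * wt N (s N + N - 1) < wt N u}"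
  defines "q \<equiv> \<lambda>N e. (\<Prod>i\<in>e. wt N i) * (1 / W N)"
  assumes l: "0 < l"
    and subcritical: "wbar * (1 - a)\<^sup>2 / (2 * a - 1) * (l powr ((2 * a - 1) / a) - 1) < 1"
    and q_le_1: "eventually (\<lambda>N. \<forall>e\<in>pairs (verts N). q N e \<le> 1) sequentially"
  shows "\<exists>c>0. \<exists>\<delta>>0. (\<lambda>N. measure_pmf.prob (random_edges (pairs (verts N)) (q N))
    {E. \<forall>V. giant_component (verts N) E V \<longrightarrow>
          c * real N \<le> real (card V) \<and> \<delta> * real (card V) \<le> real (card (V \<inter> core N))}) \<longlonglongrightarrow> 1"
proof -
  define \<nu>0 where "\<nu>0 = wbar * (1 - a)\<^sup>2 / (2 * a - 1) * (l powr ((2 * a - 1) / a) - 1)"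
  \<comment> \<open>A number above \<open>\<nu>0\<close> and below 1; the maximum with
    \<open>1 / 2\<close> keeps it positive when \<open>l < 1\<close>, where \<open>\<nu>0\<close> is
    negative. The tolerance \<open>e\<close> absorbs the errors in the second moment and in the
    total weight.\<close>
  define \<nu> where "\<nu> = max (1 / 2) ((1 + \<nu>0) / 2)"
  define e where "e = min (wbar / 2) (wbar * (1 - \<nu>0) / 8)"
  have \<nu>01: "\<nu>0 < 1" using subcritical by (simp add: \<nu>0_def)
  have \<nu>: "1 / 2 \<le> \<nu>" "(1 + \<nu>0) / 2 \<le> \<nu>" "\<nu> < 1" using \<nu>01 by (auto simp: \<nu>_def)
  have e: "0 < e" "e \<le> wbar / 2" "e \<le> wbar * (1 - \<nu>0) / 8" using wbar \<nu>01 by (auto simp: e_def)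
  have e\<nu>: "(if l < 1 then 0 else wbar * \<nu>0 + e) \<le> \<nu> * (wbar - e)"
  proof -
    have "wbar * ((1 + \<nu>0) / 2) \<le> wbar * \<nu>" using \<nu> wbar by (intro mult_left_mono) auto
    moreover have "\<nu> * e \<le> e" using \<nu> e by (simp add: mult_left_le_one_le)
    moreover have "4 * e \<le> wbar * ((1 - \<nu>0) / 2)" using e by simp
    moreover have "\<nu> * (wbar - e) = wbar * \<nu> - \<nu> * e" by (simp add: algebra_simps)
    moreover have "wbar * ((1 + \<nu>0) / 2) = wbar / 2 + wbar * \<nu>0 / 2"
      "wbar * ((1 - \<nu>0) / 2) = wbar / 2 - wbar * \<nu>0 / 2" by (simp_all add: field_simps)
    ultimately have "wbar * \<nu>0 + e \<le> \<nu> * (wbar - e)" using e(1) by linarith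
    moreover have "0 \<le> \<nu> * (wbar - e)" using \<nu> e wbar by (intro mult_nonneg_nonneg) auto
    ultimately show ?thesis by simp
  qed
  \<comment> \<open>With \<open>\<tau> / 2 * N\<close> vertices in \<open>B N\<close> and total
    weight at most \<open>2 * wbar * N\<close>, the condition
    \<open>18 \<le> \<eta> * card B\<close> reduces to
    \<open>K \<le> \<tau> powr (1 - 2 * a)\<close>. The exponent is negative because \<beta> < 3, so
    small \<open>\<tau>\<close> works. The last term in the minimum below places \<open>B N\<close>
    inside the core.\<close>
  define K where "K = 72 * wbar / \<kappa>\<^sup>2"
  define \<tau> where "\<tau> = min (1 / 2) (min (K powr (1 / (1 - 2 * a))) ((l + 1) powr (- 1 / a)))"
  have K: "0 < K" using wbar \<kappa>_pos by (simp add: K_def)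
  have \<tau>: "0 < \<tau>" "\<tau> < 1" using K l by (auto simp: \<tau>_def)
  have "(K powr (1 / (1 - 2 * a))) powr (1 - 2 * a) \<le> \<tau> powr (1 - 2 * a)"
    using a \<tau> by (intro powr_mono2') (auto simp: \<tau>_def)
  then have \<tau>K: "K \<le> \<tau> powr (1 - 2 * a)" using a K by (simp add: powr_powr)
  have "((l + 1) powr (- 1 / a)) powr (- a) \<le> \<tau> powr (- a)"
    using a \<tau> by (intro powr_mono2') (auto simp: \<tau>_def)
  then have \<tau>l: "l < \<tau> powr (- a)" using a l by (simp add: powr_powr)
  \<comment> \<open>Then \<open>3 * c = \<tau> / 2\<close>, the guaranteed density of
    \<open>B N\<close>.\<close>
  define c where "c = \<tau> / 6"
  have c: "0 < c" using \<tau> by (simp add: c_def)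
  define h where "h = l * \<kappa>"
  have h: "0 \<le> h" using l \<kappa>_pos by (simp add: h_def)
  define A where "A = nat \<lceil>8 * (1 + h / (1 - \<nu>)) / c\<rceil>"
  have H: "0 < 1 + h / (1 - \<nu>)" using h \<nu> by (intro add_pos_nonneg) auto
  then have "0 < 8 * (1 + h / (1 - \<nu>)) / c" using c by simp
  then have A: "0 < A" "8 * (1 + h / (1 - \<nu>)) / c \<le> real A" by (auto simp: A_def) 
  have A8: "(1 + h / (1 - \<nu>)) / real A \<le> c / 8" using A c by (simp add: field_simps)
  \<comment> \<open>Indices up to \<open>\<sigma> * N\<close> carry weight at most
    \<open>c / (32 * A) * N\<close>. The threshold \<open>t\<close> is the weight at index
    \<open>\<sigma> * N\<close>, so all heavier vertices are among them.\<close>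
  define \<sigma> where "\<sigma> = (c / (32 * A * wbar)) powr (1 / (1 - a))"
  have \<sigma>: "0 < \<sigma>" using c A wbar by (simp add: \<sigma>_def)
  have \<sigma>_powr: "\<sigma> powr (1 - a) = c / (32 * A * wbar)"
    using a c A wbar by (simp add: \<sigma>_def powr_powr)
  define t where "t = \<kappa> * \<sigma> powr (- a)"
  have t: "0 < t" using \<sigma> \<kappa>_pos by (simp add: t_def)
  \<comment> \<open>The truncation level for degrees, as \<open>a\<close> already names the
    exponent. The gap \<open>b - t\<close> is chosen to make \<open>t / (4 * (b - t))\<close> equal
    to \<open>c / (32 * A)\<close>.\<close>
  define b where "b = t + 8 * A * t / c"
  have b: "t < b" using A c t by (simp add: b_def)
  have tb: "t / (4 * (b - t)) \<le> c / (32 * A)" using A c t by (simp add: b_def)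
  define \<delta> where "\<delta> = min (c / (8 * A * b)) (c / 4)"
  have \<delta>: "0 < \<delta>" "\<delta> \<le> c / 4" using A c b t by (auto simp: \<delta>_def)
  have "\<delta> * b \<le> c / (8 * A * b) * b" using b t by (intro mult_right_mono) (auto simp: \<delta>_def)
  then have \<delta>b: "\<delta> * b \<le> c / (8 * A)" using b t by simp
  define B where "B = (\<lambda>N. {i \<in> verts N. real i \<le> \<tau> * real N})"
  define good where "good = (\<lambda>N. {E. \<forall>V. giant_component (verts N) E V \<longrightarrow>
          c * real N \<le> real (card V) \<and> \<delta> * real (card V) \<le> real (card (V \<inter> core N))})"
  define Q where "Q = (2 * real A)\<^sup>2 * (2 * wbar) / (c / 8)\<^sup>2 + 2\<^sup>2 * (2 * wbar) / (c / (16 * A))\<^sup>2"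
  define r where "r = 4 * exp (- 2 :: real)"
  have "5 \<le> exp (2 :: real)" using exp_lower_Taylor_quadratic[of 2] by simp
  then have r: "0 < r" "r < 1" by (auto simp: r_def exp_minus field_simps)
  have cN: "eventually (\<lambda>N. real A \<le> c * real N) sequentially"
    using c by real_asymp
  have "eventually (\<lambda>N. 1 - (r powr (\<tau> / 2 * real N) + Q / real N)
      \<le> measure_pmf.prob (random_edges (pairs (verts N)) (q N)) (good N)) sequentially"
    using s_pos eventually_gt_at_top[of 0] sum_verts_le sum_verts_ge[OF e(1)]
      low_weight_sum_le[OF l e(1), folded \<nu>0_def] card_low_index_ge[OF \<tau>] cN q_le_1
  proof eventually_elim
    case (elim N)
    interpret expected_degrees "verts N" "wt N" "1 / W N" "q N"
      using elim by unfold_locales (auto simp: W_def q_def intro: wt_pos)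
    have W_pos: "0 < W N" using sum_w_pos by (simp add: W_def)
    have Wle: "W N \<le> 2 * wbar * real N" using elim by (simp add: W_def)
    have w_last: "wt N (s N + N - 1) \<le> \<kappa>" using wt_le[of N 1 "s N + N - 1"] elim by simp
    have lw_last: "l * wt N (s N + N - 1) \<le> h" unfolding h_def using w_last l by (intro mult_left_mono) auto
    have B_w: "\<kappa> * \<tau> powr (- a) \<le> wt N u" if "u \<in> B N" for u
      using that elim \<tau> by (intro wt_ge) (auto simp: B_def)
    have low: "verts N - core N = {i \<in> verts N. wt N i \<le> l * wt N (s N + N - 1)}"
      by (auto simp: core_def)
    have BC: "B N \<subseteq> core N"
    proof
      fix u assume u: "u \<in> B N"
      have "l * wt N (s N + N - 1) \<le> \<kappa> * l" using lw_last by (simp add: h_def mult.commute)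
      also have "\<dots> < \<kappa> * \<tau> powr (- a)" using \<kappa>_pos \<tau>l by (intro mult_strict_left_mono)
      also have "\<dots> \<le> wt N u" by (rule B_w[OF u])
      finally show "u \<in> core N" using u by (simp add: core_def B_def)
    qed
    have "measure_pmf.prob (random_edges (pairs (verts N)) (q N)) {E. \<not> (\<forall>V. giant_component (verts N) E V \<longrightarrow>
          c * real N \<le> real (card V) \<and> \<delta> * real (card V) \<le> real (card (V \<inter> core N)))}
      \<le> (4 * exp (- 2)) ^ card (B N)
        + ((2 * real A)\<^sup>2 * (2 * wbar) / (c / 8)\<^sup>2 + 2\<^sup>2 * (2 * wbar) / (c / (16 * A))\<^sup>2) / real N"
    proof (rule prob_core_fraction[where \<eta> = "(\<kappa> * \<tau> powr (- a))\<^sup>2 / (2 * wbar * real N)"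
          and h = h and \<nu> = \<nu> and a = b and t = t])
      show "B N \<subseteq> core N" "core N \<subseteq> verts N" by (rule BC) (auto simp: core_def)
      show "0 < real N" "real (card (verts N)) \<le> real N" using elim by auto
      show "0 < c" by (rule c)
      show "3 * c * real N \<le> real (card (B N))" using elim by (simp add: c_def B_def)
      show "(\<kappa> * \<tau> powr (- a))\<^sup>2 / (2 * wbar * real N) \<le> q N {u, v}"
        if "u \<in> B N" "v \<in> B N" "u \<noteq> v" for u v
      proof -
        have "(\<kappa> * \<tau> powr (- a))\<^sup>2 \<le> wt N u * wt N v"
          unfolding power2_eq_square
        proof (intro mult_mono B_w that)
          have "0 \<le> \<kappa> * \<tau> powr (- a)" using \<kappa>_pos by simp
          then show "0 \<le> wt N u" "0 \<le> \<kappa> * \<tau> powr (- a)" using B_w[OF that(1)] by linarith+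
        qed
        moreover have "0 \<le> (\<kappa> * \<tau> powr (- a))\<^sup>2" by simp
        ultimately have "(\<kappa> * \<tau> powr (- a))\<^sup>2 / (2 * wbar * real N) \<le> wt N u * wt N v / W N"
          using Wle W_pos by (intro frac_le) linarith+
        then show ?thesis using that by (simp add: q_pair)
      qed
      show "18 \<le> (\<kappa> * \<tau> powr (- a))\<^sup>2 / (2 * wbar * real N) * real (card (B N))"
      proof -
        have "\<tau> powr (1 - 2 * a) = (\<tau> powr (- a))\<^sup>2 * \<tau>"
        proof -
          have "\<tau> powr (1 - 2 * a) = \<tau> powr (- a + - a + 1)" by (simp add: algebra_simps)
          also have "\<dots> = (\<tau> powr (- a))\<^sup>2 * \<tau>" unfolding powr_add using \<tau> by (simp add: power2_eq_square)
          finally show ?thesis .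
        qed
        then have "18 \<le> \<kappa>\<^sup>2 * ((\<tau> powr (- a))\<^sup>2 * \<tau>) / (4 * wbar)"
          using \<tau>K \<kappa>_pos wbar by (simp add: K_def field_simps)
        also have "\<dots> = (\<kappa> * \<tau> powr (- a))\<^sup>2 / (2 * wbar * real N) * (\<tau> / 2 * real N)"
          using elim wbar by (simp add: field_simps)
        also have "\<dots> \<le> (\<kappa> * \<tau> powr (- a))\<^sup>2 / (2 * wbar * real N) * real (card (B N))"
          using elim wbar by (intro mult_left_mono) (auto simp: B_def)
        finally show ?thesis .
      qed
      show "1 / W N * (\<Sum>u\<in>verts N - core N. (wt N u)\<^sup>2) \<le> \<nu>"
      proof -
        have "(\<Sum>u\<in>verts N - core N. (wt N u)\<^sup>2) \<le> (if l < 1 then 0 else wbar * \<nu>0 + e) * real N"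
          unfolding low using elim by simp
        also have "\<dots> \<le> \<nu> * (wbar - e) * real N" using e\<nu> by (intro mult_right_mono) auto
        also have "\<dots> = \<nu> * ((wbar - e) * real N)" by simp
        also have "\<dots> \<le> \<nu> * W N" using elim \<nu> by (intro mult_left_mono) (auto simp: W_def)
        finally show ?thesis using W_pos by (simp add: field_simps)
      qed
      show "wt N u \<le> h" if "u \<in> verts N - core N" for u
        using that lw_last unfolding low by auto
      show "(\<Sum>u\<in>verts N. wt N u) \<le> 2 * wbar * real N" using Wle by (simp add: W_def)
      show "real A \<le> c * real N" using elim by simp
      show "(\<Sum>k\<in>{k \<in> verts N. t < wt N k}. wt N k) \<le> c / real (32 * A) * real N"
      proof -
        have "{k \<in> verts N. t < wt N k} \<subseteq> {i. 0 < i \<and> real i \<le> \<sigma> * real N}"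
        proof
          fix k assume k: "k \<in> {k \<in> verts N. t < wt N k}"
          then have "\<not> \<sigma> * real N \<le> real k" using wt_le[of N \<sigma> k] \<sigma> elim by (auto simp: t_def)
          then show "k \<in> {i. 0 < i \<and> real i \<le> \<sigma> * real N}" using k elim by auto
        qed
        moreover have "finite {i. 0 < i \<and> real i \<le> \<sigma> * real N}"
          by (rule finite_subset[of _ "{..nat \<lceil>\<sigma> * real N\<rceil>}"]) (auto, linarith)
        ultimately have "(\<Sum>k\<in>{k \<in> verts N. t < wt N k}. wt N k) \<le> (\<Sum>i\<in>{i. 0 < i \<and> real i \<le> \<sigma> * real N}. wt N i)"
          using elim by (intro sum_mono2) (auto intro!: less_imp_le[OF wt_pos])
        also have "\<dots> \<le> wbar * \<sigma> powr (1 - a) * real N" using elim \<sigma> by (intro sum_wt_le) auto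
        also have "\<dots> = c / real (32 * A) * real N" using wbar A by (simp add: \<sigma>_powr)
        finally show ?thesis .
      qed
    qed (use \<nu> h A A8 t b tb \<delta> \<delta>b in auto)
    then have "measure_pmf.prob (random_edges (pairs (verts N)) (q N)) (- good N) \<le> r ^ card (B N) + Q / real N"
      by (simp only: good_def r_def Q_def Collect_neg_eq)
    also have "r ^ card (B N) \<le> r powr (\<tau> / 2 * real N)"
    proof -
      have "r powr real (card (B N)) \<le> r powr (\<tau> / 2 * real N)"
        using elim r by (intro powr_mono') (auto simp: B_def)
      then show ?thesis using r by (simp add: powr_realpow)
    qed
    finally show ?case
      using measure_pmf.prob_compl[of "good N" "random_edges (pairs (verts N)) (q N)"]
      by (simp add: Compl_eq_Diff_UNIV)
  qed
  moreover have "(\<lambda>N. 1 - (r powr (\<tau> / 2 * real N) + Q / real N)) \<longlonglongrightarrow> 1"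
  proof -
    have "r powr (\<tau> / 2) < 1 powr (\<tau> / 2)" using r \<tau> by (intro powr_less_mono2) auto
    then have "(\<lambda>N. (r powr (\<tau> / 2)) ^ N) \<longlonglongrightarrow> 0" using r by (intro LIMSEQ_realpow_zero) auto
    moreover have "(r powr (\<tau> / 2)) ^ N = r powr (\<tau> / 2 * real N)" for N
      using r by (simp add: powr_powr flip: powr_realpow)
    moreover have "(\<lambda>N. Q / real N) \<longlonglongrightarrow> 0" by real_asymp
    ultimately have "(\<lambda>N. 1 - (r powr (\<tau> / 2 * real N) + Q / real N)) \<longlonglongrightarrow> 1 - (0 + 0)"
      by (intro tendsto_intros) simp_all
    then show ?thesis by simp
  qed
  ultimately have "(\<lambda>N. measure_pmf.prob (random_edges (pairs (verts N)) (q N)) (good N)) \<longlonglongrightarrow> 1"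
    by - (rule tendsto_sandwich[OF _ _ _ tendsto_const], assumption, simp_all)
  then show ?thesis using c \<delta> unfolding good_def by blast
qed

end

section \<open>Transfer to the power-law model\<close>

lemma pl_vertices_eq:
  assumes "0 \<le> pl_i0 \<beta> wbar \<Delta> N"
  shows "pl_vertices \<beta> wbar \<Delta> N = {nat \<lceil>pl_i0 \<beta> wbar \<Delta> N\<rceil>..<nat \<lceil>pl_i0 \<beta> wbar \<Delta> N\<rceil> + N}"
proof -
  let ?x = "pl_i0 \<beta> wbar \<Delta> N"
  have eq: "(?x \<le> real i \<and> real i < real N + ?x) \<longleftrightarrow> (nat \<lceil>?x\<rceil> \<le> i \<and> i < nat \<lceil>?x\<rceil> + N)" for i
    using assms by linarith
  show ?thesis unfolding pl_vertices_def eq by (simp add: set_eq_iff)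
qed

text \<open>One margin \<open>\<epsilon>\<close> serves all \<open>N\<close>, which is what
  non-vanishing means here. Quantifying over every largest component makes ties harmless.\<close>

theorem theorem1:
  fixes \<beta> wbar g \<gamma> l :: real and \<Delta> :: "nat \<Rightarrow> real"
  assumes "2 < \<beta>" and "\<beta> < 3" and "wbar > 1" and "g > 1"
    and "filterlim \<Delta> at_top sequentially"
    and "eventually (\<lambda>N. \<forall>e\<in>pl_pairs \<beta> wbar (\<Delta> N) N. pl_edge_prob \<beta> wbar (\<Delta> N) N e \<le> 1) sequentially"
    and "\<gamma> = (1 - 1 / (\<beta> - 1))\<^sup>2 * ((\<beta> - 1) / (3 - \<beta>))"
    and "l > 0" and "l powr (3 - \<beta>) - 1 / (wbar * \<gamma>) = 0"
  shows "\<exists>\<epsilon>>0. (\<lambda>N. measure_pmf.prob (pl_graph \<beta> wbar (\<Delta> N) N)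
           {E. \<forall>V. giant_component (pl_vertices \<beta> wbar (\<Delta> N) N) E V \<longrightarrow>
                 network_gain E V (pl_core \<beta> wbar (\<Delta> N) N l V) g \<ge> 1 + \<epsilon>}) \<longlonglongrightarrow> 1"
proof -
  define a where "a = 1 / (\<beta> - 1)"
  define \<kappa> where "\<kappa> = (1 - a) * wbar"
  define I where "I = (\<lambda>N. pl_i0 \<beta> wbar (\<Delta> N) N)"
  define s where "s = (\<lambda>N. nat \<lceil>I N\<rceil>)"
  have a: "1 / 2 < a" "a < 1" using assms(1,2) by (auto simp: a_def field_simps)
  have \<kappa>: "0 < \<kappa>" using a assms(3) by (simp add: \<kappa>_def)
  have a_1: "(\<beta> - 2) / (\<beta> - 1) = 1 - a" using assms(1) by (simp add: a_def field_simps)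
  \<comment> \<open>In this form \<open>\<Delta> N\<close> tending to infinity visibly forces
    \<open>I N / N\<close> to 0; rounding up to an integer adds at most
    \<open>1 / N\<close>.\<close>
  have I_eq: "I N = real N * (\<kappa> / \<Delta> N) powr (\<beta> - 1)" for N
  proof -
    have "wbar * (\<beta> - 2) / (\<Delta> N * (\<beta> - 1)) = (\<beta> - 2) / (\<beta> - 1) * wbar / \<Delta> N" by (simp add: mult_ac)
    then show ?thesis unfolding a_1 by (simp add: I_def pl_i0_def \<kappa>_def)
  qed
  have \<Delta>_pos: "eventually (\<lambda>N. 0 < \<Delta> N) sequentially"
    using assms(5) by (simp add: filterlim_at_top_dense)
  have I_pos: "eventually (\<lambda>N. 0 < I N) sequentially"
    using \<Delta>_pos eventually_gt_at_top[of 0] by eventually_elim (use \<kappa> in \<open>simp add: I_eq\<close>)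
  have "(\<lambda>N. \<kappa> / \<Delta> N) \<longlonglongrightarrow> 0"
    using assms(5) by (intro tendsto_divide_0[OF tendsto_const] filterlim_at_top_imp_at_infinity)
  then have "(\<lambda>N. (\<kappa> / \<Delta> N) powr (\<beta> - 1)) \<longlonglongrightarrow> 0"
    using assms(1) \<kappa>
    by (intro tendsto_zero_powrI[OF _ tendsto_const] eventually_mono[OF \<Delta>_pos]) auto
  moreover have "(\<lambda>N. 1 / real N) \<longlonglongrightarrow> 0" by real_asymp
  ultimately have lim: "(\<lambda>N. (\<kappa> / \<Delta> N) powr (\<beta> - 1) + 1 / real N) \<longlonglongrightarrow> 0"
    by (auto dest: tendsto_add)
  interpret power_law a wbar \<kappa> s
  proof
    show "eventually (\<lambda>N. 0 < s N) sequentially"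
      using I_pos by eventually_elim (simp add: s_def)
    have "eventually (\<lambda>N. norm (real (s N) / real N) \<le> (\<kappa> / \<Delta> N) powr (\<beta> - 1) + 1 / real N) sequentially"
      using I_pos eventually_gt_at_top[of 0]
    proof eventually_elim
      case (elim N)
      have "real (s N) \<le> I N + 1" using elim by (simp add: s_def)
      then have "real (s N) / real N \<le> (I N + 1) / real N" by (rule divide_right_mono) simp
      also have "\<dots> = (\<kappa> / \<Delta> N) powr (\<beta> - 1) + 1 / real N" using elim by (simp add: I_eq field_simps)
      finally show ?case by simp
    qed
    then show "(\<lambda>N. real (s N) / real N) \<longlonglongrightarrow> 0" by (rule Lim_null_comparison[OF _ lim])
  qed (use a assms(3) \<kappa>_def in auto)
  have wt_eq: "pl_weight \<beta> wbar N = wt N" for N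
    by (intro ext, unfold pl_weight_def pl_c_def wt_def a_1) (simp add: \<kappa>_def a_def)
  have verts_eq: "eventually (\<lambda>N. pl_vertices \<beta> wbar (\<Delta> N) N = verts N) sequentially"
    using I_pos by eventually_elim (simp add: pl_vertices_eq s_def I_def)
  define W where "W = (\<lambda>N. \<Sum>i\<in>verts N. wt N i)"
  define q where "q = (\<lambda>N e. (\<Prod>i\<in>e. wt N i) * (1 / W N))"
  define core where "core = (\<lambda>N. {u \<in> verts N. l * wt N (s N + N - 1) < wt N u})"
  have q_eq: "eventually (\<lambda>N. pl_edge_prob \<beta> wbar (\<Delta> N) N = q N) sequentially"
    using verts_eq by eventually_elim (simp add: pl_edge_prob_def[abs_def] pl_rho_def q_def W_def wt_eq)
  have pairs_eq: "pl_pairs \<beta> wbar (\<Delta> N) N = pairs (pl_vertices \<beta> wbar (\<Delta> N) N)" for N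
    by (simp add: pl_pairs_def pairs_def)
  have wmin_eq: "eventually (\<lambda>N. pl_wmin \<beta> wbar (\<Delta> N) N = wt N (s N + N - 1)) sequentially"
    using verts_eq s_pos eventually_gt_at_top[of 0]
    by eventually_elim (auto simp: pl_wmin_def wt_eq intro!: Min_eqI wt_antimono)
  \<comment> \<open>In terms of \<beta> one has \<open>(2 * a - 1) / a = 3 - \<beta>\<close> and
    \<open>(1 - a)\<^sup>2 / (2 * a - 1) = \<gamma>\<close>, so the equation for \<open>l\<close>
    turns the left-hand side into \<open>1 - wbar * \<gamma>\<close>.\<close>
  have subcritical: "wbar * (1 - a)\<^sup>2 / (2 * a - 1) * (l powr ((2 * a - 1) / a) - 1) < 1"
  proof -
    have "2 * a - 1 = (3 - \<beta>) / (\<beta> - 1)" using assms(1) by (simp add: a_def field_simps)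
    then have "(2 * a - 1) / a = 3 - \<beta>" and \<gamma>: "(1 - a)\<^sup>2 / (2 * a - 1) = \<gamma>"
      using assms(1) by (simp_all add: assms(7) a_def)
    then have eq: "wbar * (1 - a)\<^sup>2 / (2 * a - 1) * (l powr ((2 * a - 1) / a) - 1) = wbar * \<gamma> * (l powr (3 - \<beta>) - 1)"
      by (metis times_divide_eq_right)
    have "0 < \<gamma>" using a by (simp flip: \<gamma>)
    moreover have "l powr (3 - \<beta>) = 1 / (wbar * \<gamma>)" using assms(9) by simp
    ultimately show ?thesis unfolding eq using assms(3) by (simp add: field_simps)
  qed
  have q_le_1: "eventually (\<lambda>N. \<forall>e\<in>pairs (verts N). q N e \<le> 1) sequentially"
    using assms(6) verts_eq q_eq by eventually_elim (simp add: pairs_eq)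
  have "\<exists>c>0. \<exists>\<delta>>0. (\<lambda>N. measure_pmf.prob (random_edges (pairs (verts N)) (q N))
      {E. \<forall>V. giant_component (verts N) E V \<longrightarrow>
          c * real N \<le> real (card V) \<and> \<delta> * real (card V) \<le> real (card (V \<inter> core N))}) \<longlonglongrightarrow> 1"
    unfolding q_def W_def core_def
    by (rule core_fraction_whp[OF assms(8) subcritical q_le_1[unfolded q_def W_def]])
  then obtain c \<delta> where c: "0 < c" and \<delta>: "0 < \<delta>"
    and lim1: "(\<lambda>N. measure_pmf.prob (random_edges (pairs (verts N)) (q N))
      {E. \<forall>V. giant_component (verts N) E V \<longrightarrow>
          c * real N \<le> real (card V) \<and> \<delta> * real (card V) \<le> real (card (V \<inter> core N))}) \<longlonglongrightarrow> 1"
    by (elim exE conjE)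
  define \<epsilon> where "\<epsilon> = (1 - 1 / g) * \<delta> / 2"
  have \<epsilon>: "0 < \<epsilon>" using assms(4) \<delta> by (simp add: \<epsilon>_def)
  \<comment> \<open>Linear size gives the two vertices that the gain bound requires.\<close>
  have cN: "eventually (\<lambda>N. 2 \<le> c * real N) sequentially" using c by real_asymp
  have "eventually (\<lambda>N. measure_pmf.prob (random_edges (pairs (verts N)) (q N))
      {E. \<forall>V. giant_component (verts N) E V \<longrightarrow>
          c * real N \<le> real (card V) \<and> \<delta> * real (card V) \<le> real (card (V \<inter> core N))}
    \<le> measure_pmf.prob (pl_graph \<beta> wbar (\<Delta> N) N)
           {E. \<forall>V. giant_component (pl_vertices \<beta> wbar (\<Delta> N) N) E V \<longrightarrow>
                 network_gain E V (pl_core \<beta> wbar (\<Delta> N) N l V) g \<ge> 1 + \<epsilon>}) sequentially"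
    using verts_eq q_eq wmin_eq cN
  proof eventually_elim
    case (elim N)
    have graph: "pl_graph \<beta> wbar (\<Delta> N) N = random_edges (pairs (verts N)) (q N)"
      unfolding pl_graph_def random_edges_def pairs_eq elim ..
    have "AE E in measure_pmf (random_edges (pairs (verts N)) (q N)). E \<subseteq> pairs (verts N)"
      using set_random_edges[of "pairs (verts N)" "q N"] by (auto simp: AE_measure_pmf_iff)
    then have "AE E in measure_pmf (random_edges (pairs (verts N)) (q N)).
        E \<in> {E. \<forall>V. giant_component (verts N) E V \<longrightarrow>
          c * real N \<le> real (card V) \<and> \<delta> * real (card V) \<le> real (card (V \<inter> core N))} \<longrightarrow>
        E \<in> {E. \<forall>V. giant_component (verts N) E V \<longrightarrow>
                 network_gain E V (pl_core \<beta> wbar (\<Delta> N) N l V) g \<ge> 1 + \<epsilon>}"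
    proof eventually_elim
      case E: (elim E)
      show ?case
      proof (intro impI CollectI allI)
        fix V assume good: "E \<in> {E. \<forall>V. giant_component (verts N) E V \<longrightarrow>
          c * real N \<le> real (card V) \<and> \<delta> * real (card V) \<le> real (card (V \<inter> core N))}"
          and V: "giant_component (verts N) E V"
        have comp: "V \<in> components (verts N) E" using V by (simp add: giant_component_def)
        have sub: "V \<subseteq> verts N"
          using E by (intro components_subset[OF _ comp]) (auto simp: pairs_def)
        have core: "pl_core \<beta> wbar (\<Delta> N) N l V = V \<inter> core N"
          using sub elim by (auto simp: pl_core_def core_def wt_eq)
        have big: "c * real N \<le> real (card V)" "\<delta> * real (card V) \<le> real (card (V \<inter> core N))"
          using good V by auto
        show "1 + \<epsilon> \<le> network_gain E V (pl_core \<beta> wbar (\<Delta> N) N l V) g"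
          unfolding core \<epsilon>_def
        proof (rule network_gain_ge[OF comp _ _ assms(4) _ \<delta> big(2)])
          show "finite V" using sub by (rule finite_subset) simp
          show "2 \<le> card V" using big(1) elim by linarith
        qed simp
      qed
    qed
    then show ?case unfolding graph elim(1)
      by (intro measure_pmf.finite_measure_mono_AE) auto
  qed
  then have "(\<lambda>N. measure_pmf.prob (pl_graph \<beta> wbar (\<Delta> N) N)
           {E. \<forall>V. giant_component (pl_vertices \<beta> wbar (\<Delta> N) N) E V \<longrightarrow>
                 network_gain E V (pl_core \<beta> wbar (\<Delta> N) N l V) g \<ge> 1 + \<epsilon>}) \<longlonglongrightarrow> 1"
    by (intro tendsto_sandwich[OF _ _ lim1 tendsto_const]) auto
  with \<epsilon> show ?thesis by blast
qed

end
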